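(* For $j=1,2$, let $F_j\in C^2(\mathbb{R})$ be non-increasing with $F_j(0)=0$, and assume that $F_j$ is (real) analytic on $\mathbb{R}$. For $\delta\in[0,1]$ let $u_{j,\delta}\in C^{2+\alpha}(\overline{\Omega})$ be the solution of $$-|a|^{\frac12}\sum_{i,k=1}^n \partial_{x_i}\left(|a|^{-\frac12}a_{i,k}\,\partial_{x_k}u_{j,\delta}\right)=F_j(u_{j,\delta})\ \text{in }\Omega,\qquad u_{j,\delta}=\delta g\ \text{on }\partial\Omega.$$ Let $x_0\in\partial\Omega$ be arbitrary and let $(\delta_k)_{k\in\mathbb{N}}$ be a decreasing sequence in $(0,1]$ that converges to zero. Then the condition $$\partial_{\nu_a}u_{1,\delta_k}(x_0)=\partial_{\nu_a}u_{2,\delta_k}(x_0)\quad\text{for all }k\in\mathbb{N}$$ implies that $F_1=F_2$.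
   Context: Let $n\ge2$, $\alpha\in(0,1)$, and let $\Omega\subset\mathbb{R}^n$ be a bounded connected domain with $C^{2+\alpha}$ boundary. Let $a=(a_{i,j})_{1\le i,j\le n}\in C^2(\overline{\Omega};\mathbb{R}^{n^2})$ be symmetric ($a_{i,j}=a_{j,i}$) and elliptic: there is $c>0$ with $\sum_{i,j}a_{i,j}(x)\xi_i\xi_j\ge c|\xi|^2$ for all $x\in\overline\Omega$, $\xi\in\mathbb{R}^n$. $|a|$ denotes the absolute value of the determinant of $a$. Let $g\in C^{2+\alpha}(\partial\Omega)$ satisfy $g(\partial\Omega)=[0,R]$ with $R>0$. For non-increasing $F\in C^1(\mathbb{R})$ with $F(0)=0$, the boundary value problem with source $F(u)$ and Dirichlet data $\delta g$ has a unique solution in $C^{2+\alpha}(\overline\Omega)$ for every $\delta\in[0,1]$. With $\nu$ the outward unit normal to $\partial\Omega$, $\partial_{\nu_a}v(x)=\sum_{i,j=1}^n a_{i,j}(x)\,\partial_{x_j}v(x)\,\nu_i(x)$ for $x\in\partial\Omega$. *)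

theory Defs
  imports "HOL-Analysis.Analysis"
begin

section \<open>Functions of class \<open>C^k\<close> and \<open>C^(k+\<alpha>)\<close> on the closure of an open set\<close>

definition partial_deriv :: "'n::finite \<Rightarrow> (real^'n \<Rightarrow> real) \<Rightarrow> real^'n \<Rightarrow> real" where
  "partial_deriv i f x = deriv (\<lambda>t. f (x + t *\<^sub>R axis i 1)) 0"

definition has_partial :: "'n::finite \<Rightarrow> (real^'n \<Rightarrow> real) \<Rightarrow> real^'n \<Rightarrow> bool" where
  "has_partial i f x \<longleftrightarrow> (\<lambda>t. f (x + t *\<^sub>R axis i 1)) field_differentiable (at 0)"

text \<open>The partial derivative on the open set \<open>\<Omega>\<close>, extended to the boundary by its limit from
  inside \<open>\<Omega>\<close>. The values of the function outside \<open>\<Omega>\<close> play no role.\<close>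

definition partial_cl :: "(real^'n) set \<Rightarrow> 'n::finite \<Rightarrow> (real^'n \<Rightarrow> real) \<Rightarrow> real^'n \<Rightarrow> real" where
  "partial_cl \<Omega> i f x =
     (if x \<in> \<Omega> then partial_deriv i f x else Lim (at x within \<Omega>) (partial_deriv i f))"

definition partials_cl ::
    "(real^'n) set \<Rightarrow> 'n::finite list \<Rightarrow> (real^'n \<Rightarrow> real) \<Rightarrow> real^'n \<Rightarrow> real" where
  "partials_cl \<Omega> is f = foldr (partial_cl \<Omega>) is f"

text \<open>\<open>C^k\<close> up to the boundary: all partial derivatives of order at most \<open>k\<close> exist in \<open>\<Omega>\<close> and
  extend continuously to the closure (for order 0: \<open>f\<close> itself is continuous on the closure).\<close>

definition Ck_closure :: "nat \<Rightarrow> (real^'n::finite) set \<Rightarrow> (real^'n \<Rightarrow> real) \<Rightarrow> bool" where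
  "Ck_closure k \<Omega> f \<longleftrightarrow>
     (\<forall>is. length is \<le> k \<longrightarrow> continuous_on (closure \<Omega>) (partials_cl \<Omega> is f)) \<and>
     (\<forall>is i. length is < k \<longrightarrow> (\<forall>x\<in>\<Omega>. has_partial i (partials_cl \<Omega> is f) x))"

definition holder_on :: "real \<Rightarrow> 'a::metric_space set \<Rightarrow> ('a \<Rightarrow> real) \<Rightarrow> bool" where
  "holder_on \<alpha> S f \<longleftrightarrow> (\<exists>C. \<forall>x\<in>S. \<forall>y\<in>S. \<bar>f x - f y\<bar> \<le> C * dist x y powr \<alpha>)"

definition Ck_holder_closure ::
    "nat \<Rightarrow> real \<Rightarrow> (real^'n::finite) set \<Rightarrow> (real^'n \<Rightarrow> real) \<Rightarrow> bool" where
  "Ck_holder_closure k \<alpha> \<Omega> f \<longleftrightarrow>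
     Ck_closure k \<Omega> f \<and>
     (\<forall>is. length is = k \<longrightarrow> holder_on \<alpha> (closure \<Omega>) (partials_cl \<Omega> is f))"

section \<open>Domains with \<open>C^(k+\<alpha>)\<close> boundary\<close>

text \<open>In the ball of radius \<open>r\<close> around \<open>x0\<close>, and in the orthonormal coordinates \<open>y = Q x\<close>, the set
  \<open>\<Omega>\<close> is the part above the graph of \<open>\<gamma>\<close>. A function of the \<open>n - 1\<close> coordinates other than \<open>y $ m\<close>
  is encoded as a function on \<open>real^'n\<close> that does not depend on \<open>y $ m\<close>.\<close>

definition boundary_chart ::
    "nat \<Rightarrow> real \<Rightarrow> (real^'n::finite) set \<Rightarrow> real^'n \<Rightarrow>
     real \<Rightarrow> (real^'n \<Rightarrow> real^'n) \<Rightarrow> 'n \<Rightarrow> (real^'n \<Rightarrow> real) \<Rightarrow> bool" where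
  "boundary_chart k \<alpha> \<Omega> x0 r Q m \<gamma> \<longleftrightarrow>
     r > 0 \<and> orthogonal_transformation Q \<and>
     (\<forall>y z. (\<forall>i. i \<noteq> m \<longrightarrow> y $ i = z $ i) \<longrightarrow> \<gamma> y = \<gamma> z) \<and>
     Ck_holder_closure k \<alpha> (ball (Q x0) r) \<gamma> \<and>
     \<Omega> \<inter> ball x0 r = {x \<in> ball x0 r. Q x $ m > \<gamma> (Q x)}"

definition Ck_holder_boundary :: "nat \<Rightarrow> real \<Rightarrow> (real^'n::finite) set \<Rightarrow> bool" where
  "Ck_holder_boundary k \<alpha> \<Omega> \<longleftrightarrow>
     (\<forall>x0\<in>frontier \<Omega>. \<exists>r Q m \<gamma>. boundary_chart k \<alpha> \<Omega> x0 r Q m \<gamma>)"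

text \<open>Regularity of a function on the boundary, read in the local graph parametrization
  \<open>y' \<mapsto> (y', \<gamma> y')\<close>. The radius \<open>\<rho>\<close> may have to be smaller than that of the chart, so that the
  parametrized points lie in the ball where the graph describes the boundary.\<close>

definition Ck_holder_on_boundary ::
    "nat \<Rightarrow> real \<Rightarrow> (real^'n::finite) set \<Rightarrow> (real^'n \<Rightarrow> real) \<Rightarrow> bool" where
  "Ck_holder_on_boundary k \<alpha> \<Omega> g \<longleftrightarrow>
     (\<forall>x0\<in>frontier \<Omega>. \<exists>r Q m \<gamma>. boundary_chart k \<alpha> \<Omega> x0 r Q m \<gamma> \<and>
        (\<exists>\<rho>>0. Ck_holder_closure k \<alpha> (ball (Q x0) \<rho>)
           (\<lambda>y. g (inv Q (\<chi> i. if i = m then \<gamma> y else y $ i)))))"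

text \<open>\<open>\<nu>\<close> is a unit vector, orthogonal to the boundary at \<open>x\<close> (to first order), and points out of
  \<open>\<Omega>\<close>. On a domain with \<open>C\<^sup>1\<close> boundary in dimension at least two there is exactly one such vector
  at each boundary point.\<close>

definition outward_unit_normal :: "(real^'n::finite) set \<Rightarrow> real^'n \<Rightarrow> real^'n \<Rightarrow> bool" where
  "outward_unit_normal \<Omega> x \<nu> \<longleftrightarrow>
     norm \<nu> = 1 \<and>
     ((\<lambda>y. ((y - x) \<bullet> \<nu>) / norm (y - x)) \<longlongrightarrow> 0) (at x within frontier \<Omega>) \<and>
     (\<forall>\<^sub>F t in at_right 0. x + t *\<^sub>R \<nu> \<notin> \<Omega> \<and> x - t *\<^sub>R \<nu> \<in> \<Omega>)"

section \<open>The boundary value problem\<close>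

definition elliptic_op ::
    "(real^'n \<Rightarrow> real^'n^'n::finite) \<Rightarrow> (real^'n \<Rightarrow> real) \<Rightarrow> real^'n \<Rightarrow> real" where
  "elliptic_op a u x =
     - (\<bar>det (a x)\<bar> powr (1/2)) *
       (\<Sum>i\<in>UNIV. \<Sum>k\<in>UNIV. partial_deriv i
          (\<lambda>y. \<bar>det (a y)\<bar> powr (- 1/2) * a y $ i $ k * partial_deriv k u y) x)"

definition is_solution ::
    "real \<Rightarrow> (real^'n) set \<Rightarrow> (real^'n \<Rightarrow> real^'n^'n::finite) \<Rightarrow> (real \<Rightarrow> real) \<Rightarrow>
     (real^'n \<Rightarrow> real) \<Rightarrow> (real^'n \<Rightarrow> real) \<Rightarrow> bool" where
  "is_solution \<alpha> \<Omega> a F h u \<longleftrightarrow>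
     Ck_holder_closure 2 \<alpha> \<Omega> u \<and>
     (\<forall>x\<in>\<Omega>. elliptic_op a u x = F (u x)) \<and>
     (\<forall>x\<in>frontier \<Omega>. u x = h x)"

definition conormal_deriv ::
    "(real^'n) set \<Rightarrow> (real^'n \<Rightarrow> real^'n^'n::finite) \<Rightarrow> (real^'n \<Rightarrow> real^'n) \<Rightarrow>
     (real^'n \<Rightarrow> real) \<Rightarrow> real^'n \<Rightarrow> real" where
  "conormal_deriv \<Omega> a \<nu> v x =
     (\<Sum>i\<in>UNIV. \<Sum>j\<in>UNIV. a x $ i $ j * partial_cl \<Omega> j v x * \<nu> x $ i)"

section \<open>Nonlinearities\<close>

definition C2_real :: "(real \<Rightarrow> real) \<Rightarrow> bool" where
  "C2_real F \<longleftrightarrow>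
     (\<forall>x. F field_differentiable (at x)) \<and>
     (\<forall>x. deriv F field_differentiable (at x)) \<and>
     continuous_on UNIV (deriv (deriv F))"

definition real_analytic :: "(real \<Rightarrow> real) \<Rightarrow> bool" where
  "real_analytic F \<longleftrightarrow> (\<forall>x. \<exists>P. (\<lambda>h. F (x + h)) has_fps_expansion P)"

end

theory Submission
  imports Defs
begin

text \<open>
  The theorem rests on the sign of \<open>F1 - F2\<close> near \<open>0\<close> and on Hopf's boundary point lemma, applied to
  the difference of the two solutions for one small amplitude \<open>\<delta> k\<close> of the boundary data.

  Suppose \<open>F1 \<noteq> F2\<close>. The difference is analytic and not identically zero, so its zero at \<open>0\<close> is
  isolated and it has a constant strict sign on some interval \<open>(0, s0)\<close>
  (\<open>real_analytic_sign_near_0\<close>). Choose \<open>k\<close> with \<open>\<delta> k * R < s0\<close>; by symmetry let \<open>F2 < F1\<close> on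
  \<open>(0, \<delta> k * R]\<close>. Write the equation in nondivergence form \<open>- L u\<^sub>j = F\<^sub>j(u\<^sub>j)\<close>
  (\<open>elliptic_op_nondivergence\<close>). Since \<open>F\<^sub>j\<close> is non-increasing and vanishes at \<open>0\<close>, the weak maximum
  principle (\<open>comparison\<close>) gives \<open>0 \<le> u\<^sub>j \<le> \<delta> k * R\<close>, so only the values of \<open>F1\<close> and \<open>F2\<close> on that
  interval enter. For \<open>w = u1 - u2\<close> the equations give
  \<open>- L w = (F1(u1) - F1(u2)) + (F1 - F2)(u2)\<close>, where the last term is nonnegative. The monotonicity
  of \<open>F1\<close> and comparison give \<open>w \<ge> 0\<close>, and a Lipschitz constant \<open>K\<close> of \<open>F1\<close> then gives
  \<open>L w \<le> K w\<close>. By the strong minimum principle either \<open>w > 0\<close> in the domain or \<open>w = 0\<close> throughout. In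
  the second case \<open>(F1 - F2)(u2) = 0\<close>, hence \<open>u2 = 0\<close> in the domain and, by continuity, on its
  boundary, where \<open>u2 = \<delta> k * g\<close> is not identically zero.

  So \<open>w > 0\<close> inside and \<open>w = 0\<close> on the boundary. A boundary of class \<open>C\<^sup>2\<close> is touched at \<open>x0\<close> by a ball
  from inside (\<open>interior_ball_of_chart\<close>), and Hopf's lemma, in the form \<open>hopf_oblique\<close>, says that
  \<open>w\<close> grows at least linearly along every direction that enters this ball. By ellipticity
  \<open>d = - a\<^sup>T \<nu>\<close> is such a direction, and the derivative of \<open>w\<close> along \<open>d\<close> at \<open>x0\<close> is minus the
  difference of the two conormal derivatives. These are therefore different
  (\<open>conormal_derivatives_differ\<close>).
\<close>

section \<open>Positive semidefinite matrices\<close>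

text \<open>Completing the square, one variable at a time. If \<open>a s s > 0\<close>, the rank one form with entries
  \<open>a s i * a s j / a s s\<close> can be split off, and the rest is still positive semidefinite because its value
  at \<open>\<xi>\<close> is the minimum of the original form over all changes of the coordinate \<open>\<xi> s\<close>. If
  \<open>a s s = 0\<close>, positivity forces the whole row \<open>s\<close> to vanish.\<close>

lemma psd_sum_of_squares_support:
  fixes a :: "'n::finite \<Rightarrow> 'n \<Rightarrow> real"
  assumes "finite S"
    and "\<And>i j. a i j = a j i"
    and "\<And>\<xi>. 0 \<le> (\<Sum>i\<in>UNIV. \<Sum>j\<in>UNIV. a i j * \<xi> i * \<xi> j)"
    and "\<And>i j. i \<notin> S \<Longrightarrow> a i j = 0"
  shows "\<exists>v. \<forall>i j. a i j = (\<Sum>s\<in>S. v s i * v s j)"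
  using assms
proof (induction S arbitrary: a rule: finite_induct)
  case empty
  then show ?case by auto
next
  case (insert s S)
  note sym = insert.prems(1) and psd = insert.prems(2) and supp = insert.prems(3)
  have expand: "(\<Sum>i\<in>UNIV. \<Sum>j\<in>UNIV. a i j * (\<xi> i + (if i = s then t else 0)) * (\<xi> j + (if j = s then t else 0)))
     = (\<Sum>i\<in>UNIV. \<Sum>j\<in>UNIV. a i j * \<xi> i * \<xi> j) + 2 * t * (\<Sum>j\<in>UNIV. a s j * \<xi> j) + t\<^sup>2 * a s s"
    for \<xi> :: "'n \<Rightarrow> real" and t
  proof -
    have "(\<Sum>i\<in>UNIV. \<Sum>j\<in>UNIV. a i j * (\<xi> i + (if i = s then t else 0)) * (\<xi> j + (if j = s then t else 0)))
      = (\<Sum>i\<in>UNIV. \<Sum>j\<in>UNIV. a i j * \<xi> i * \<xi> j + (if i = s then t * (a i j * \<xi> j) else 0)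
          + (if j = s then t * (a i j * \<xi> i) else 0) + (if i = s then if j = s then t\<^sup>2 * a i j else 0 else 0))"
      by (intro sum.cong refl) (auto simp: algebra_simps power2_eq_square)
    also have "\<dots> = (\<Sum>i\<in>UNIV. \<Sum>j\<in>UNIV. a i j * \<xi> i * \<xi> j)
        + (\<Sum>i\<in>UNIV. \<Sum>j\<in>UNIV. (if i = s then t * (a i j * \<xi> j) else 0))
        + (\<Sum>i\<in>UNIV. \<Sum>j\<in>UNIV. (if j = s then t * (a i j * \<xi> i) else 0))
        + (\<Sum>i\<in>UNIV. \<Sum>j\<in>UNIV. (if i = s then if j = s then t\<^sup>2 * a i j else 0 else 0))"
      by (simp add: sum.distrib)
    also have "(\<Sum>i\<in>UNIV. \<Sum>j\<in>UNIV. (if i = s then t * (a i j * \<xi> j) else 0)) = t * (\<Sum>j\<in>UNIV. a s j * \<xi> j)"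
      by (subst sum.swap) (simp add: sum_distrib_left)
    also have "(\<Sum>i\<in>UNIV. \<Sum>j\<in>UNIV. (if j = s then t * (a i j * \<xi> i) else 0)) = t * (\<Sum>j\<in>UNIV. a s j * \<xi> j)"
      by (simp add: sum_distrib_left sym)
    also have "(\<Sum>i\<in>UNIV. \<Sum>j\<in>UNIV. (if i = s then if j = s then t\<^sup>2 * a i j else 0 else 0)) = t\<^sup>2 * a s s"
      by (subst sum.swap) simp
    finally show ?thesis by (simp add: algebra_simps)
  qed
  have poly: "0 \<le> (\<Sum>i\<in>UNIV. \<Sum>j\<in>UNIV. a i j * \<xi> i * \<xi> j) + 2 * t * (\<Sum>j\<in>UNIV. a s j * \<xi> j) + t\<^sup>2 * a s s"
    for \<xi> :: "'n \<Rightarrow> real" and t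
    using psd[of "\<lambda>i. \<xi> i + (if i = s then t else 0)"] unfolding expand .
  have ass: "0 \<le> a s s"
    using poly[of "\<lambda>_. 0" 1] by simp
  show ?case
  proof (cases "a s s = 0")
    case True
    have row: "a s j = 0" for j
    proof (rule ccontr)
      assume n: "a s j \<noteq> 0"
      define e where "e = (\<lambda>k. if k = j then 1 else 0 :: real)"
      have e1: "(\<Sum>i\<in>UNIV. \<Sum>k\<in>UNIV. a i k * e i * e k) = a j j"
        by (simp add: e_def if_distrib[where f="\<lambda>x. _ * x"] cong: if_cong)
      have e2: "(\<Sum>k\<in>UNIV. a s k * e k) = a s j"
        by (simp add: e_def if_distrib[where f="\<lambda>x. _ * x"] cong: if_cong)
      \<comment> \<open>With \<open>a s s = 0\<close> the form is affine in \<open>t\<close>; this \<open>t\<close> makes its value \<open>-1\<close>.\<close>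
      have "0 \<le> a j j + 2 * (- (a j j + 1) / (2 * a s j)) * a s j"
        using poly[of e "- (a j j + 1) / (2 * a s j)"] e1 e2 True by simp
      also have "\<dots> = -1" using n by (simp add: field_simps)
      finally show False by simp
    qed
    then have "\<exists>v. \<forall>i j. a i j = (\<Sum>s\<in>S. v s i * v s j)"
      by (intro insert.IH sym psd) (metis supp insert_iff)
    then obtain v where v: "\<forall>i j. a i j = (\<Sum>s\<in>S. v s i * v s j)" by blast
    have "\<forall>i j. a i j = (\<Sum>q\<in>insert s S. (v(s := (\<lambda>_. 0))) q i * (v(s := (\<lambda>_. 0))) q j)"
    proof (intro allI)
      fix i j
      have "(\<Sum>q\<in>S. (v(s := (\<lambda>_. 0))) q i * (v(s := (\<lambda>_. 0))) q j) = (\<Sum>s\<in>S. v s i * v s j)"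
        using insert.hyps by (intro sum.cong) auto
      then show "a i j = (\<Sum>q\<in>insert s S. (v(s := (\<lambda>_. 0))) q i * (v(s := (\<lambda>_. 0))) q j)"
        using insert.hyps v by simp
    qed
    then show ?thesis by blast
  next
    case False
    with ass have pos: "a s s > 0" by simp
    define a' where "a' i j = a i j - a s i * a s j / a s s" for i j
    have "\<exists>v. \<forall>i j. a' i j = (\<Sum>s\<in>S. v s i * v s j)"
    proof (rule insert.IH)
      show "a' i j = a' j i" for i j by (simp add: a'_def sym[of i j])
      show "a' i j = 0" if "i \<notin> S" for i j
        using that supp[of i j] supp[of i s] sym[of s i] pos by (cases "i = s") (auto simp: a'_def)
      show "0 \<le> (\<Sum>i\<in>UNIV. \<Sum>j\<in>UNIV. a' i j * \<xi> i * \<xi> j)" for \<xi> :: "'n \<Rightarrow> real"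
      proof -
        define L where "L = (\<Sum>j\<in>UNIV. a s j * \<xi> j)"
        have "(\<Sum>i\<in>UNIV. \<Sum>j\<in>UNIV. a' i j * \<xi> i * \<xi> j)
          = (\<Sum>i\<in>UNIV. \<Sum>j\<in>UNIV. a i j * \<xi> i * \<xi> j)
            - (\<Sum>i\<in>UNIV. \<Sum>j\<in>UNIV. (a s i * \<xi> i) * (a s j * \<xi> j)) / a s s"
          unfolding a'_def sum_divide_distrib sum_subtractf[symmetric]
          by (intro sum.cong refl) (simp add: field_simps)
        also have "(\<Sum>i\<in>UNIV. \<Sum>j\<in>UNIV. (a s i * \<xi> i) * (a s j * \<xi> j)) = L * L"
          by (simp add: L_def sum_product)
        \<comment> \<open>\<open>t = - L / a s s\<close> is the minimizer of the quadratic polynomial \<open>poly\<close>.\<close>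
        also have "(\<Sum>i\<in>UNIV. \<Sum>j\<in>UNIV. a i j * \<xi> i * \<xi> j) - L * L / a s s
           = (\<Sum>i\<in>UNIV. \<Sum>j\<in>UNIV. a i j * \<xi> i * \<xi> j) + 2 * (- L / a s s) * L + (- L / a s s)\<^sup>2 * a s s"
          using pos by (simp add: field_simps power2_eq_square)
        also have "\<dots> \<ge> 0" unfolding L_def by (rule poly)
        finally show ?thesis .
      qed
    qed
    then obtain v where v: "\<forall>i j. a' i j = (\<Sum>s\<in>S. v s i * v s j)" by blast
    define v' where "v' = v(s := (\<lambda>i. a s i / sqrt (a s s)))"
    have "\<forall>i j. a i j = (\<Sum>q\<in>insert s S. v' q i * v' q j)"
    proof (intro allI)
      fix i j
      have "(\<Sum>q\<in>S. v' q i * v' q j) = a' i j"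
        using insert.hyps v by (auto intro!: sum.cong simp: v'_def)
      moreover have "v' s i * v' s j = a s i * a s j / a s s"
        using pos by (simp add: v'_def)
      ultimately show "a i j = (\<Sum>q\<in>insert s S. v' q i * v' q j)"
        using insert.hyps by (simp add: a'_def)
    qed
    then show ?thesis by blast
  qed
qed

text \<open>The left factor of the trace is a sum of rank one matrices \<open>v v\<^sup>T\<close>, and each of them contributes
  \<open>v \<bullet> (H *v v)\<close>.\<close>

lemma psd_trace_nonneg:
  fixes A H :: "real^'n^'n::finite"
  assumes sym: "\<And>i j. A $ i $ j = A $ j $ i"
    and psd: "\<And>\<xi>::real^'n. 0 \<le> (\<Sum>i\<in>UNIV. \<Sum>j\<in>UNIV. A $ i $ j * \<xi> $ i * \<xi> $ j)"
    and H: "\<And>\<xi>::real^'n. 0 \<le> \<xi> \<bullet> (H *v \<xi>)"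
  shows "0 \<le> (\<Sum>i\<in>UNIV. \<Sum>j\<in>UNIV. A $ i $ j * H $ i $ j)"
proof -
  have "\<exists>v :: 'n \<Rightarrow> 'n \<Rightarrow> real. \<forall>i j. A $ i $ j = (\<Sum>s\<in>UNIV. v s i * v s j)"
  proof (rule psd_sum_of_squares_support[where a = "\<lambda>i j. A $ i $ j"])
    show "0 \<le> (\<Sum>i\<in>UNIV. \<Sum>j\<in>UNIV. A $ i $ j * \<xi> i * \<xi> j)" for \<xi> :: "'n \<Rightarrow> real"
      using psd[of "\<chi> i. \<xi> i"] by simp
  qed (auto simp: sym)
  then obtain v :: "'n \<Rightarrow> 'n \<Rightarrow> real" where v: "\<And>i j. A $ i $ j = (\<Sum>s\<in>UNIV. v s i * v s j)" by blast
  have "(\<Sum>i\<in>UNIV. \<Sum>j\<in>UNIV. A $ i $ j * H $ i $ j)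
      = (\<Sum>i\<in>UNIV. \<Sum>j\<in>UNIV. \<Sum>s\<in>UNIV. v s i * v s j * H $ i $ j)"
    by (simp add: v sum_distrib_right)
  also have "\<dots> = (\<Sum>i\<in>UNIV. \<Sum>s\<in>UNIV. \<Sum>j\<in>UNIV. v s i * v s j * H $ i $ j)"
    by (rule sum.cong[OF refl]) (rule sum.swap)
  also have "\<dots> = (\<Sum>s\<in>UNIV. \<Sum>i\<in>UNIV. \<Sum>j\<in>UNIV. v s i * v s j * H $ i $ j)"
    by (rule sum.swap)
  also have "\<dots> = (\<Sum>s\<in>UNIV. (\<chi> i. v s i) \<bullet> (H *v (\<chi> i. v s i)))"
    by (simp add: inner_vec_def matrix_vector_mult_def sum_distrib_left mult_ac)
  also have "\<dots> \<ge> 0" by (intro sum_nonneg H)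
  finally show ?thesis .
qed

section \<open>First and second derivatives\<close>

text \<open>The fields \<open>G\<close> and \<open>H\<close> are the gradient and the Hessian of \<open>u\<close>. Carrying them as data makes the
  maximum principles apply alike to solutions, to linear combinations of solutions and to explicit
  barriers.\<close>

definition has_jet ::
    "(real^'n) set \<Rightarrow> (real^'n \<Rightarrow> real) \<Rightarrow> (real^'n \<Rightarrow> real^'n) \<Rightarrow> (real^'n \<Rightarrow> real^'n^'n::finite) \<Rightarrow> bool"
  where "has_jet S u G H \<longleftrightarrow>
    (\<forall>x\<in>S. (u has_derivative (\<lambda>h. G x \<bullet> h)) (at x) \<and> (G has_derivative (\<lambda>h. H x *v h)) (at x))"

lemma has_jet_subset: "has_jet S u G H \<Longrightarrow> T \<subseteq> S \<Longrightarrow> has_jet T u G H"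
  by (auto simp: has_jet_def)

lemma has_jet_lincomb:
  assumes "has_jet S u G H" "has_jet S v G' H'"
  shows "has_jet S (\<lambda>x. p * u x + q * v x + s) (\<lambda>x. p *\<^sub>R G x + q *\<^sub>R G' x) (\<lambda>x. p *\<^sub>R H x + q *\<^sub>R H' x)"
  unfolding has_jet_def
proof (intro ballI conjI)
  fix x assume "x \<in> S"
  then have d: "(u has_derivative (\<lambda>h. G x \<bullet> h)) (at x)" "(G has_derivative (\<lambda>h. H x *v h)) (at x)"
    "(v has_derivative (\<lambda>h. G' x \<bullet> h)) (at x)" "(G' has_derivative (\<lambda>h. H' x *v h)) (at x)"
    using assms by (auto simp: has_jet_def)
  show "((\<lambda>x. p * u x + q * v x + s) has_derivative (\<lambda>h. (p *\<^sub>R G x + q *\<^sub>R G' x) \<bullet> h)) (at x)"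
    by (rule has_derivative_eq_rhs, (rule derivative_intros d)+) (auto simp: inner_simps)
  show "((\<lambda>x. p *\<^sub>R G x + q *\<^sub>R G' x) has_derivative (\<lambda>h. (p *\<^sub>R H x + q *\<^sub>R H' x) *v h)) (at x)"
    by (rule has_derivative_eq_rhs, (rule derivative_intros d)+)
       (auto simp: matrix_vector_mult_add_rdistrib scaleR_matrix_vector_assoc)
qed

lemma line_derivative:
  assumes "(u has_derivative u') (at (y + t *\<^sub>R \<xi>))"
  shows "((\<lambda>t::real. u (y + t *\<^sub>R \<xi>)) has_derivative (\<lambda>s. u' (s *\<^sub>R \<xi>))) (at t within T)"
proof -
  have "((\<lambda>t. y + t *\<^sub>R \<xi>) has_derivative (\<lambda>s. s *\<^sub>R \<xi>)) (at t within T)"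
    by (auto intro!: derivative_eq_intros)
  from has_derivative_compose[OF this assms] show ?thesis .
qed

lemma has_jet_line:
  assumes "has_jet S u G H" "y + t *\<^sub>R \<xi> \<in> S"
  shows "((\<lambda>t. u (y + t *\<^sub>R \<xi>)) has_real_derivative G (y + t *\<^sub>R \<xi>) \<bullet> \<xi>) (at t within T)"
    and "((\<lambda>t. G (y + t *\<^sub>R \<xi>) \<bullet> \<xi>) has_real_derivative \<xi> \<bullet> (H (y + t *\<^sub>R \<xi>) *v \<xi>)) (at t within T)"
proof -
  have d: "(u has_derivative (\<lambda>h. G (y + t *\<^sub>R \<xi>) \<bullet> h)) (at (y + t *\<^sub>R \<xi>))"
    "(G has_derivative (\<lambda>h. H (y + t *\<^sub>R \<xi>) *v h)) (at (y + t *\<^sub>R \<xi>))"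
    using assms by (auto simp: has_jet_def)
  show "((\<lambda>t. u (y + t *\<^sub>R \<xi>)) has_real_derivative G (y + t *\<^sub>R \<xi>) \<bullet> \<xi>) (at t within T)"
    unfolding has_field_derivative_def
    by (rule has_derivative_eq_rhs[OF line_derivative[OF d(1)]]) (auto simp: fun_eq_iff)
  show "((\<lambda>t. G (y + t *\<^sub>R \<xi>) \<bullet> \<xi>) has_real_derivative \<xi> \<bullet> (H (y + t *\<^sub>R \<xi>) *v \<xi>)) (at t within T)"
    unfolding has_field_derivative_def
    by (rule has_derivative_eq_rhs[OF has_derivative_inner_left[OF line_derivative[OF d(2)]]])
       (auto simp: fun_eq_iff inner_commute linear_cmul[OF matrix_vector_mul_linear])
qed

text \<open>If \<open>\<xi> \<bullet> (H y *v \<xi>)\<close> were negative, the slope of \<open>u\<close> along \<open>\<xi>\<close> would decrease through zero at \<open>y\<close>,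
  and \<open>u\<close> would drop below its minimum on the way.\<close>

lemma interior_min_jet:
  assumes S: "open S" "y \<in> S" and jet: "has_jet S u G H" and min: "\<And>x. x \<in> S \<Longrightarrow> u y \<le> u x"
  shows "G y = 0" and "0 \<le> \<xi> \<bullet> (H y *v \<xi>)"
proof -
  have "(u has_derivative (\<lambda>h. G y \<bullet> h)) (at y)" using jet S by (auto simp: has_jet_def)
  from differential_zero_maxmin[OF S(2,1) this] min have "(\<lambda>h. G y \<bullet> h) = (\<lambda>v. 0)" by blast
  then have "G y \<bullet> G y = 0" by meson
  then show G0: "G y = 0" by simp
  show "0 \<le> \<xi> \<bullet> (H y *v \<xi>)"
  proof (rule ccontr)
    assume neg: "\<not> 0 \<le> \<xi> \<bullet> (H y *v \<xi>)"
    define \<psi> where "\<psi> t = G (y + t *\<^sub>R \<xi>) \<bullet> \<xi>" for t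
    have "(\<psi> has_real_derivative \<xi> \<bullet> (H y *v \<xi>)) (at 0)"
      using has_jet_line(2)[OF jet, of y 0 \<xi>] S unfolding \<psi>_def by simp
    from DERIV_neg_dec_right[OF this] neg obtain d where d: "d > 0" "\<And>h. 0 < h \<Longrightarrow> h < d \<Longrightarrow> \<psi> h < \<psi> 0"
      by auto
    have psi0: "\<psi> 0 = 0" by (simp add: \<psi>_def G0)
    have "\<forall>\<^sub>F t in at 0. y + t *\<^sub>R \<xi> \<in> S"
    proof (rule topological_tendstoD)
      show "((\<lambda>t. y + t *\<^sub>R \<xi>) \<longlongrightarrow> y) (at 0)" by (auto intro!: tendsto_eq_intros)
    qed (use S in auto)
    then obtain d' where d': "d' > 0" "\<And>t. t \<noteq> 0 \<Longrightarrow> \<bar>t\<bar> < d' \<Longrightarrow> y + t *\<^sub>R \<xi> \<in> S"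
      by (auto simp: eventually_at)
    define t where "t = min d d' / 2"
    have t: "0 < t" "t < d" "t < d'" using d d' by (auto simp: t_def)
    have inS: "y + s *\<^sub>R \<xi> \<in> S" if "0 \<le> s" "s \<le> t" for s
      using d'(2)[of s] that t S by (cases "s = 0") auto
    have "\<exists>s>0. s < t \<and> u (y + t *\<^sub>R \<xi>) - u (y + 0 *\<^sub>R \<xi>) = (t - 0) * \<psi> s"
    proof (rule MVT2)
      show "((\<lambda>t. u (y + t *\<^sub>R \<xi>)) has_real_derivative \<psi> s) (at s)" if "0 \<le> s" "s \<le> t" for s
        unfolding \<psi>_def by (rule has_jet_line(1)[OF jet inS[OF that]])
    qed (rule t)
    then obtain s where s: "0 < s" "s < t" "u (y + t *\<^sub>R \<xi>) - u y = t * \<psi> s" by auto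
    have "\<psi> s < 0" using d(2)[of s] s t psi0 by auto
    then have "u (y + t *\<^sub>R \<xi>) < u y" using s t mult_pos_neg[of t "\<psi> s"] by auto
    with min[OF inS[of t]] t show False by auto
  qed
qed

text \<open>The increment is split into steps parallel to the axes. Each step is compared with the partial
  derivative at \<open>x\<close> by the mean value inequality, and the truncated increments stay in the ball on which
  the partial derivatives are within \<open>e / N\<close> of their values at \<open>x\<close>.\<close>

lemma continuous_partials_imp_has_derivative:
  fixes f :: "real^'n::finite \<Rightarrow> real"
  assumes S: "open S" "x \<in> S"
    and p: "\<And>i y. y \<in> S \<Longrightarrow> ((\<lambda>t. f (y + t *\<^sub>R axis i 1)) has_real_derivative p i y) (at 0)"
    and cont: "\<And>i. continuous_on S (p i)"
  shows "(f has_derivative (\<lambda>h. (\<chi> i. p i x) \<bullet> h)) (at x)"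
  unfolding has_derivative_at_alt
proof (intro conjI allI impI)
  show "bounded_linear (\<lambda>h. (\<chi> i. p i x) \<bullet> h)" by (rule bounded_linear_inner_right)
  fix e :: real assume e: "e > 0"
  define N where "N = real CARD('n)"
  have N: "N > 0" by (simp add: N_def)
  have "\<forall>\<^sub>F z in nhds x. z \<in> S \<and> (\<forall>i. \<bar>p i z - p i x\<bar> < e / N)"
  proof (intro eventually_conj eventually_nhds_in_open S eventually_all_finite)
    fix i
    have "isCont (p i) x" using cont S continuous_on_eq_continuous_at by blast
    then have "(p i \<longlongrightarrow> p i x) (nhds x)" by (simp add: isCont_def tendsto_nhds_iff)
    from tendstoD[OF this, of "e / N"] e N show "\<forall>\<^sub>F z in nhds x. \<bar>p i z - p i x\<bar> < e / N"
      by (simp add: dist_real_def)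
  qed
  then obtain d where d: "d > 0" "\<And>z. dist z x < d \<Longrightarrow> z \<in> S" "\<And>z i. dist z x < d \<Longrightarrow> \<bar>p i z - p i x\<bar> < e / N"
    unfolding eventually_nhds_metric by blast
  show "\<exists>d>0. \<forall>y. norm (y - x) < d \<longrightarrow> norm (f y - f x - (\<chi> i. p i x) \<bullet> (y - x)) \<le> e * norm (y - x)"
  proof (intro exI[of _ d] conjI d(1) allI impI)
    fix y assume y: "norm (y - x) < d"
    define h where "h = y - x"
    define part where "part I = (\<chi> i. if i \<in> I then h $ i else 0)" for I
    have main: "\<bar>f (x + part I) - f x - (\<Sum>i\<in>I. h $ i * p i x)\<bar> \<le> (\<Sum>i\<in>I. \<bar>h $ i\<bar> * (e / N))" for I :: "'n set"
    proof (induction I rule: finite_induct[OF finite])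
      case 1
      have "part {} = 0" by (simp add: part_def vec_eq_iff)
      then show ?case by simp
    next
      case (2 j I)
      \<comment> \<open>The linear part is subtracted, so that the derivative of \<open>k\<close> is small.\<close>
      define k where "k s = f (x + part I + s *\<^sub>R axis j 1) - s * p j x" for s
      have step: "part (insert j I) = part I + (h $ j) *\<^sub>R axis j 1"
        using 2 by (auto simp: part_def vec_eq_iff axis_def)
      have near: "dist (x + part I + s *\<^sub>R axis j 1) x < d" if "\<bar>s\<bar> \<le> \<bar>h $ j\<bar>" for s
      proof -
        have "norm (part I + s *\<^sub>R axis j 1) \<le> norm h"
          by (rule norm_le_componentwise_cart) (use 2 that in \<open>auto simp: part_def axis_def\<close>)
        then show ?thesis using y by (simp add: dist_norm h_def add.assoc)
      qed
      have "norm (k (h $ j) - k 0) \<le> (e / N) * norm (h $ j - 0)"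
      proof (rule field_differentiable_bound)
        show "convex {-\<bar>h $ j\<bar>..\<bar>h $ j\<bar>}" by simp
        fix s assume "s \<in> {-\<bar>h $ j\<bar>..\<bar>h $ j\<bar>}"
        then have s: "\<bar>s\<bar> \<le> \<bar>h $ j\<bar>" by auto
        have "((\<lambda>t. f (x + part I + s *\<^sub>R axis j 1 + t *\<^sub>R axis j 1)) has_real_derivative
            p j (x + part I + s *\<^sub>R axis j 1)) (at (s - s))"
          using p[OF d(2)[OF near[OF s]], of j] by simp
        then have "((\<lambda>t. f (x + part I + s *\<^sub>R axis j 1 + (t - s) *\<^sub>R axis j 1)) has_real_derivative
            p j (x + part I + s *\<^sub>R axis j 1)) (at s)"
          using DERIV_shift[of "\<lambda>t. f (x + part I + s *\<^sub>R axis j 1 + t *\<^sub>R axis j 1)" _ s "-s"] by simp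
        then have "((\<lambda>t. f (x + part I + t *\<^sub>R axis j 1)) has_real_derivative
            p j (x + part I + s *\<^sub>R axis j 1)) (at s)"
          by (simp add: algebra_simps)
        moreover have "((\<lambda>s. s * p j x) has_real_derivative p j x) (at s)"
          by (auto intro!: derivative_eq_intros)
        ultimately show "(k has_field_derivative p j (x + part I + s *\<^sub>R axis j 1) - p j x) (at s within {-\<bar>h $ j\<bar>..\<bar>h $ j\<bar>})"
          unfolding k_def by (intro has_field_derivative_at_within[OF DERIV_diff])
        show "norm (p j (x + part I + s *\<^sub>R axis j 1) - p j x) \<le> e / N"
          using d(3)[OF near[OF s], of j] by simp
      qed auto
      then have "\<bar>f (x + part (insert j I)) - f (x + part I) - h $ j * p j x\<bar> \<le> \<bar>h $ j\<bar> * (e / N)"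
        by (simp add: k_def step add.assoc mult.commute algebra_simps)
      with "2" show ?case by simp
    qed
    have "part UNIV = h" by (simp add: part_def vec_eq_iff)
    with main[of UNIV] have "\<bar>f y - f x - (\<Sum>i\<in>UNIV. h $ i * p i x)\<bar> \<le> (\<Sum>i\<in>UNIV. \<bar>h $ i\<bar> * (e / N))"
      by (simp add: h_def)
    also have "\<dots> \<le> (\<Sum>i\<in>(UNIV::'n set). norm h * (e / N))"
      by (intro sum_mono mult_right_mono component_le_norm_cart) (use e N in auto)
    also have "\<dots> = e * norm h" using N by (simp add: N_def)
    finally show "norm (f y - f x - (\<chi> i. p i x) \<bullet> (y - x)) \<le> e * norm (y - x)"
      by (simp add: inner_vec_def h_def mult.commute)
  qed
qed

lemma has_partial_iff:
  "has_partial i f x \<longleftrightarrow> ((\<lambda>t. f (x + t *\<^sub>R axis i 1)) has_real_derivative partial_deriv i f x) (at 0)"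
  by (simp add: has_partial_def partial_deriv_def DERIV_deriv_iff_field_differentiable)

lemma eventually_line_in_open:
  fixes x :: "'a::real_normed_vector"
  assumes "open S" "x \<in> S"
  shows "\<forall>\<^sub>F t in nhds (0::real). x + t *\<^sub>R v \<in> S"
proof (rule topological_tendstoD)
  have "isCont (\<lambda>t::real. x + t *\<^sub>R v) 0" by (intro continuous_intros)
  then show "((\<lambda>t. x + t *\<^sub>R v) \<longlongrightarrow> x) (nhds 0)" by (simp add: isCont_def tendsto_nhds_iff)
qed (use assms in auto)

lemma partial_cong_open:
  assumes "open S" "x \<in> S" "\<And>y. y \<in> S \<Longrightarrow> f y = g y"
  shows "has_partial i f x \<longleftrightarrow> has_partial i g x" and "partial_deriv i f x = partial_deriv i g x"
proof -
  have ev: "\<forall>\<^sub>F t in nhds 0. f (x + t *\<^sub>R axis i 1) = g (x + t *\<^sub>R axis i 1)"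
    using eventually_line_in_open[OF assms(1,2), of "axis i 1"] by eventually_elim (rule assms(3))
  show "partial_deriv i f x = partial_deriv i g x"
    unfolding partial_deriv_def by (rule deriv_cong_ev[OF ev]) simp
  show "has_partial i f x \<longleftrightarrow> has_partial i g x"
    unfolding has_partial_def field_differentiable_def
    using DERIV_cong_ev[OF refl ev refl] by blast
qed

definition grad :: "(real^'n \<Rightarrow> real) \<Rightarrow> real^'n \<Rightarrow> real^'n::finite" where
  "grad u x = (\<chi> i. partial_deriv i u x)"

text \<open>The second index is that of the outer derivative, so that the Hessian is the matrix of the derivative
  of the gradient.\<close>

definition hess :: "(real^'n \<Rightarrow> real) \<Rightarrow> real^'n \<Rightarrow> real^'n^'n::finite" where
  "hess u x = (\<chi> i j. partial_deriv j (partial_deriv i u) x)"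

lemma partials_cl_simps [simp]:
  "partials_cl \<Omega> [] f = f"
  "partials_cl \<Omega> [i] f = partial_cl \<Omega> i f"
  "partials_cl \<Omega> [i, j] f = partial_cl \<Omega> i (partial_cl \<Omega> j f)"
  by (simp_all add: partials_cl_def)

lemma Ck_closure_2D:
  assumes "Ck_closure 2 \<Omega> f"
  shows "continuous_on (closure \<Omega>) f" "continuous_on (closure \<Omega>) (partial_cl \<Omega> i f)"
    "continuous_on (closure \<Omega>) (partial_cl \<Omega> i (partial_cl \<Omega> j f))"
    "x \<in> \<Omega> \<Longrightarrow> has_partial i f x" "x \<in> \<Omega> \<Longrightarrow> has_partial i (partial_cl \<Omega> j f) x"
proof -
  have c: "length is \<le> 2 \<Longrightarrow> continuous_on (closure \<Omega>) (partials_cl \<Omega> is f)"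
    and h: "length is < 2 \<Longrightarrow> x \<in> \<Omega> \<Longrightarrow> has_partial i (partials_cl \<Omega> is f) x" for "is" i x
    using assms by (auto simp: Ck_closure_def)
  show "continuous_on (closure \<Omega>) f" "continuous_on (closure \<Omega>) (partial_cl \<Omega> i f)"
    "continuous_on (closure \<Omega>) (partial_cl \<Omega> i (partial_cl \<Omega> j f))"
    using c[of "[]"] c[of "[i]"] c[of "[i, j]"] by simp_all
  show "x \<in> \<Omega> \<Longrightarrow> has_partial i f x" "x \<in> \<Omega> \<Longrightarrow> has_partial i (partial_cl \<Omega> j f) x"
    using h[of "[]" x i] h[of "[j]" x i] by simp_all
qed

text \<open>Inside the open set, the iterated boundary-extended derivatives are the ordinary iterated
  derivatives.\<close>

lemma Ck_closure_2_partials: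
  assumes "open \<Omega>" "Ck_closure 2 \<Omega> f"
  shows "continuous_on \<Omega> (partial_deriv i f)"
    "continuous_on \<Omega> (partial_deriv i (partial_deriv j f))"
    "x \<in> \<Omega> \<Longrightarrow> has_partial i (partial_deriv j f) x"
    "x \<in> \<Omega> \<Longrightarrow> partial_cl \<Omega> i (partial_cl \<Omega> j f) x = partial_deriv i (partial_deriv j f) x"
proof -
  have eq: "\<And>y. y \<in> \<Omega> \<Longrightarrow> partial_cl \<Omega> j f y = partial_deriv j f y" for j
    by (simp add: partial_cl_def)
  note C = Ck_closure_2D[OF assms(2)]
  show "continuous_on \<Omega> (partial_deriv i f)"
    using continuous_on_subset[OF C(2) closure_subset] eq by (rule continuous_on_eq)
  have two: "partial_cl \<Omega> i (partial_cl \<Omega> j f) x = partial_deriv i (partial_deriv j f) x" if "x \<in> \<Omega>" for x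
    using partial_cong_open(2)[OF assms(1) that, of "partial_cl \<Omega> j f" "partial_deriv j f" i] eq that
    by (simp add: partial_cl_def[of _ i])
  then show "x \<in> \<Omega> \<Longrightarrow> partial_cl \<Omega> i (partial_cl \<Omega> j f) x = partial_deriv i (partial_deriv j f) x" .
  show "continuous_on \<Omega> (partial_deriv i (partial_deriv j f))"
    using continuous_on_subset[OF C(3) closure_subset] two by (rule continuous_on_eq)
  show "has_partial i (partial_deriv j f) x" if "x \<in> \<Omega>"
    using partial_cong_open(1)[OF assms(1) that, of "partial_cl \<Omega> j f" "partial_deriv j f" i] eq C(5)[OF that]
    by simp
qed

lemma Ck_closure_2_has_jet:
  assumes "open \<Omega>" "Ck_closure 2 \<Omega> f"
  shows "has_jet \<Omega> f (grad f) (hess f)"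
  unfolding has_jet_def
proof (intro ballI conjI)
  fix x assume x: "x \<in> \<Omega>"
  note C = Ck_closure_2_partials[OF assms]
  show "(f has_derivative (\<lambda>h. grad f x \<bullet> h)) (at x)"
    unfolding grad_def
    by (rule continuous_partials_imp_has_derivative[OF assms(1) x])
       (use Ck_closure_2D(4)[OF assms(2)] C in \<open>auto simp: has_partial_iff\<close>)
  have "((\<lambda>x. partial_deriv i f x) has_derivative (\<lambda>h. (\<chi> j. partial_deriv j (partial_deriv i f) x) \<bullet> h)) (at x)" for i
    by (rule continuous_partials_imp_has_derivative[OF assms(1) x])
       (use C in \<open>auto simp: has_partial_iff\<close>)
  then have "((\<lambda>x. \<chi> i. partial_deriv i f x) has_derivative
       (\<lambda>h. \<chi> i. (\<chi> j. partial_deriv j (partial_deriv i f) x) \<bullet> h)) (at x)"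
    by (subst has_derivative_componentwise_within) (auto simp: Basis_vec_def inner_axis)
  then show "(grad f has_derivative (\<lambda>h. hess f x *v h)) (at x)"
    unfolding grad_def hess_def by (simp add: matrix_vector_mult_def inner_vec_def)
qed

section \<open>Maximum principles and Hopf's lemma\<close>

text \<open>The second-order operator with leading coefficients \<open>A\<close> and drift \<open>b\<close>, as a function of the gradient
  and Hessian fields.\<close>

definition nondiv_op ::
    "(real^'n \<Rightarrow> real^'n^'n) \<Rightarrow> (real^'n \<Rightarrow> real^'n) \<Rightarrow> (real^'n \<Rightarrow> real^'n) \<Rightarrow> (real^'n \<Rightarrow> real^'n^'n) \<Rightarrow>
     real^'n::finite \<Rightarrow> real" where
  "nondiv_op A b G H x = (\<Sum>i\<in>UNIV. \<Sum>j\<in>UNIV. A x $ i $ j * H x $ i $ j) + b x \<bullet> G x"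

lemma nondiv_op_lincomb:
  "nondiv_op A b (\<lambda>x. p *\<^sub>R G x + q *\<^sub>R G' x) (\<lambda>x. p *\<^sub>R H x + q *\<^sub>R H' x) x
    = p * nondiv_op A b G H x + q * nondiv_op A b G' H' x"
  by (simp add: nondiv_op_def inner_simps sum_distrib_left sum.distrib algebra_simps)

text \<open>The Gaussian barrier of Hopf: for large \<open>l\<close> its second radial derivative dominates all other terms away
  from the centre \<open>z\<close>.\<close>

definition bump :: "real \<Rightarrow> real^'n \<Rightarrow> real^'n::finite \<Rightarrow> real" where
  "bump l z x = exp (- l * ((x - z) \<bullet> (x - z)))"

definition bump_grad :: "real \<Rightarrow> real^'n \<Rightarrow> real^'n \<Rightarrow> real^'n::finite" where
  "bump_grad l z x = (- 2 * l * bump l z x) *\<^sub>R (x - z)"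

definition bump_hess :: "real \<Rightarrow> real^'n \<Rightarrow> real^'n \<Rightarrow> real^'n^'n::finite" where
  "bump_hess l z x = (\<chi> i j. bump l z x * (4 * l\<^sup>2 * ((x - z) $ i * (x - z) $ j) - (if i = j then 2 * l else 0)))"

lemma bump_has_jet: "has_jet S (bump l z) (bump_grad l z) (bump_hess l z)"
  unfolding has_jet_def
proof (intro ballI conjI)
  fix x
  have d: "(bump l z has_derivative (\<lambda>h. bump_grad l z x \<bullet> h)) (at x)"
    unfolding bump_def[abs_def] bump_grad_def
    by (auto intro!: derivative_eq_intros simp: inner_commute algebra_simps)
  then show "(bump l z has_derivative (\<lambda>h. bump_grad l z x \<bullet> h)) (at x)" .
  have "((\<lambda>x. (- 2 * l * bump l z x) *\<^sub>R (x - z)) has_derivative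
      (\<lambda>h. (- 2 * l * bump l z x) *\<^sub>R h + (- 2 * l * (bump_grad l z x \<bullet> h)) *\<^sub>R (x - z))) (at x)"
    by (auto intro!: derivative_eq_intros d)
  moreover have "(- 2 * l * bump l z x) *\<^sub>R h + (- 2 * l * (bump_grad l z x \<bullet> h)) *\<^sub>R (x - z) = bump_hess l z x *v h" for h
  proof -
    have "(bump_hess l z x *v h) $ i
        = (- 2 * l * bump l z x) * h $ i + (- 2 * l * (bump_grad l z x \<bullet> h)) * (x - z) $ i" for i
    proof -
      have "(bump_hess l z x *v h) $ i = (\<Sum>j\<in>UNIV. (4 * l\<^sup>2 * bump l z x * (x - z) $ i) * ((x - z) $ j * h $ j)
          - (if j = i then 2 * l * bump l z x * h $ i else 0))"
        unfolding bump_hess_def matrix_vector_mult_def by (auto intro!: sum.cong simp: algebra_simps)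
      also have "\<dots> = (4 * l\<^sup>2 * bump l z x * (x - z) $ i) * ((x - z) \<bullet> h) - 2 * l * bump l z x * h $ i"
        by (simp add: sum_subtractf inner_vec_def sum_distrib_left)
      finally show ?thesis by (simp add: bump_grad_def power2_eq_square algebra_simps)
    qed
    then show ?thesis by (simp add: vec_eq_iff)
  qed
  ultimately show "(bump_grad l z has_derivative (\<lambda>h. bump_hess l z x *v h)) (at x)"
    unfolding bump_grad_def[abs_def] by simp
qed

lemma nondiv_op_bump:
  "nondiv_op A b (bump_grad l z) (bump_hess l z) x = bump l z x *
     (4 * l\<^sup>2 * (\<Sum>i\<in>UNIV. \<Sum>j\<in>UNIV. A x $ i $ j * (x - z) $ i * (x - z) $ j)
      - 2 * l * (\<Sum>i\<in>UNIV. A x $ i $ i) - 2 * l * (b x \<bullet> (x - z)))"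
proof -
  have "(\<Sum>i\<in>UNIV. \<Sum>j\<in>UNIV. A x $ i $ j * bump_hess l z x $ i $ j)
    = (\<Sum>i\<in>UNIV. \<Sum>j\<in>UNIV. bump l z x * 4 * l\<^sup>2 * (A x $ i $ j * (x - z) $ i * (x - z) $ j)
        - (if j = i then bump l z x * 2 * l * A x $ i $ i else 0))"
    unfolding bump_hess_def by (intro sum.cong refl) (auto simp: algebra_simps)
  also have "\<dots> = bump l z x * 4 * l\<^sup>2 * (\<Sum>i\<in>UNIV. \<Sum>j\<in>UNIV. A x $ i $ j * (x - z) $ i * (x - z) $ j)
      - bump l z x * 2 * l * (\<Sum>i\<in>UNIV. A x $ i $ i)"
    by (simp add: sum_subtractf sum_distrib_left)
  finally show ?thesis
    unfolding nondiv_op_def by (simp add: bump_grad_def algebra_simps)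
qed

lemma bump_pos: "bump l z x > 0" by (simp add: bump_def)

lemma bump_le_1: "l \<ge> 0 \<Longrightarrow> bump l z x \<le> 1"
  by (simp add: bump_def)

lemma continuous_on_bump: "continuous_on S (bump l z)"
  unfolding bump_def[abs_def] by (intro continuous_intros)

text \<open>Expanding the square of the distance to \<open>z\<close> gives the linear term \<open>- 2 * t * (d \<bullet> (z - p))\<close>; for small
  \<open>t\<close> half of it absorbs the quadratic term.\<close>

lemma eventually_enters_ball:
  fixes p z d :: "'a::real_inner"
  assumes p: "norm (p - z) = r" and d: "d \<bullet> (z - p) > 0"
  shows "\<forall>\<^sub>F t in at_right 0. norm (p + t *\<^sub>R d - z) < r \<and>
    (p + t *\<^sub>R d - z) \<bullet> (p + t *\<^sub>R d - z) \<le> r\<^sup>2 - t * (d \<bullet> (z - p))"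
proof -
  have r: "r \<ge> 0" using p by auto
  have "((\<lambda>t. t * (d \<bullet> d)) \<longlongrightarrow> 0 * (d \<bullet> d)) (at_right (0::real))" by (intro tendsto_intros)
  from order_tendstoD(2)[OF this, of "d \<bullet> (z - p)"] d
  have "\<forall>\<^sub>F t in at_right 0. t * (d \<bullet> d) < d \<bullet> (z - p)" by simp
  then show ?thesis
    using eventually_at_right_less[of 0]
  proof eventually_elim
    case (elim t)
    have eq: "(p + t *\<^sub>R d - z) \<bullet> (p + t *\<^sub>R d - z) = r\<^sup>2 - 2 * t * (d \<bullet> (z - p)) + t * (t * (d \<bullet> d))"
      unfolding p[symmetric] power2_norm_eq_inner by (simp add: inner_simps inner_commute algebra_simps)
    have "t * (t * (d \<bullet> d)) \<le> t * (d \<bullet> (z - p))" using elim by (intro mult_left_mono) auto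
    with eq have le: "(p + t *\<^sub>R d - z) \<bullet> (p + t *\<^sub>R d - z) \<le> r\<^sup>2 - t * (d \<bullet> (z - p))"
      by linarith
    moreover have "t * (d \<bullet> (z - p)) > 0" using elim d by simp
    ultimately have "(norm (p + t *\<^sub>R d - z))\<^sup>2 < r\<^sup>2" by (simp add: power2_norm_eq_inner)
    then have "norm (p + t *\<^sub>R d - z) < r" using r by (rule power2_less_imp_less)
    with le show ?case by blast
  qed
qed

text \<open>An upper bound for the trace is enough to control the second-order terms of the barrier, since the rest
  of its leading part has the good sign by ellipticity.\<close>

locale elliptic_operator =
  fixes \<Omega> :: "(real^'n::finite) set" and A :: "real^'n \<Rightarrow> real^'n^'n" and b :: "real^'n \<Rightarrow> real^'n"
    and c T B :: real
  assumes open_dom: "open \<Omega>" and bounded_dom: "bounded \<Omega>"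
    and sym: "x \<in> \<Omega> \<Longrightarrow> A x $ i $ j = A x $ j $ i"
    and c_pos: "c > 0"
    and elliptic: "x \<in> \<Omega> \<Longrightarrow> c * (norm \<xi>)\<^sup>2 \<le> (\<Sum>i\<in>UNIV. \<Sum>j\<in>UNIV. A x $ i $ j * \<xi> $ i * \<xi> $ j)"
    and trace_bound: "x \<in> \<Omega> \<Longrightarrow> (\<Sum>i\<in>UNIV. A x $ i $ i) \<le> T"
    and drift_bound: "x \<in> \<Omega> \<Longrightarrow> norm (b x) \<le> B"
begin

abbreviation "L \<equiv> nondiv_op A b"

text \<open>The barrier satisfies \<open>L bump / bump \<ge> 4 * c * \<rho>\<^sup>2 * l\<^sup>2 - 2 * l * (T + B * S)\<close> in the given
  annulus, and the quadratic term in \<open>l\<close> wins.\<close>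

lemma bump_subsolution:
  assumes "\<rho> > 0" "K \<ge> 0"
  obtains l where "l > 0"
    "\<And>x. x \<in> \<Omega> \<Longrightarrow> \<rho> \<le> norm (x - z) \<Longrightarrow> norm (x - z) \<le> S \<Longrightarrow>
       L (bump_grad l z) (bump_hess l z) x > K * bump l z x"
proof -
  define M where "M = 2 * (\<bar>T\<bar> + \<bar>B\<bar> * \<bar>S\<bar>) + K"
  define l where "l = 1 + M / (4 * c * \<rho>\<^sup>2)"
  have M: "M \<ge> 0" using assms by (simp add: M_def)
  have l: "l \<ge> 1" using M c_pos by (simp add: l_def)
  show thesis
  proof (rule that[of l])
    show "l > 0" using l by simp
    fix x assume x: "x \<in> \<Omega>" and r: "\<rho> \<le> norm (x - z)" "norm (x - z) \<le> S"
    let ?Q = "\<Sum>i\<in>UNIV. \<Sum>j\<in>UNIV. A x $ i $ j * (x - z) $ i * (x - z) $ j"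
    have "\<rho>\<^sup>2 \<le> (norm (x - z))\<^sup>2" using assms r by (intro power_mono) auto
    then have "c * \<rho>\<^sup>2 \<le> ?Q" using elliptic[OF x, of "x - z"] c_pos
      by (meson less_eq_real_def mult_left_mono order_trans)
    then have 1: "4 * l\<^sup>2 * (c * \<rho>\<^sup>2) \<le> 4 * l\<^sup>2 * ?Q" by (intro mult_left_mono) auto
    have "l * (4 * c * \<rho>\<^sup>2) = 4 * c * \<rho>\<^sup>2 + M" using c_pos assms by (simp add: l_def field_simps)
    then have "l * (l * (4 * c * \<rho>\<^sup>2)) = l * (4 * c * \<rho>\<^sup>2 + M)" by simp
    then have 2: "4 * l\<^sup>2 * (c * \<rho>\<^sup>2) = l * (4 * c * \<rho>\<^sup>2) + l * M"
      by (simp add: power2_eq_square algebra_simps)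
    have pos: "l * (4 * c * \<rho>\<^sup>2) > 0" using l c_pos assms by simp
    have "b x \<bullet> (x - z) \<le> norm (b x) * norm (x - z)" by (rule norm_cauchy_schwarz)
    also have "\<dots> \<le> \<bar>B\<bar> * \<bar>S\<bar>" using drift_bound[OF x] r by (intro mult_mono) auto
    finally have "(\<Sum>i\<in>UNIV. A x $ i $ i) + b x \<bullet> (x - z) \<le> \<bar>T\<bar> + \<bar>B\<bar> * \<bar>S\<bar>"
      using trace_bound[OF x] by linarith
    then have "2 * l * ((\<Sum>i\<in>UNIV. A x $ i $ i) + b x \<bullet> (x - z)) \<le> 2 * l * (\<bar>T\<bar> + \<bar>B\<bar> * \<bar>S\<bar>)"
      using l by (intro mult_left_mono) auto
    moreover have "l * M = 2 * l * (\<bar>T\<bar> + \<bar>B\<bar> * \<bar>S\<bar>) + l * K" by (simp add: M_def algebra_simps)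
    moreover have "K \<le> l * K" using l assms by (simp add: mult_le_cancel_right1)
    ultimately have "K < 4 * l\<^sup>2 * ?Q - 2 * l * (\<Sum>i\<in>UNIV. A x $ i $ i) - 2 * l * (b x \<bullet> (x - z))"
      using 1 2 pos by (simp only: distrib_left)
    then have "bump l z x * K < bump l z x * (4 * l\<^sup>2 * ?Q - 2 * l * (\<Sum>i\<in>UNIV. A x $ i $ i) - 2 * l * (b x \<bullet> (x - z)))"
      using bump_pos by (intro mult_strict_left_mono)
    then show "L (bump_grad l z) (bump_hess l z) x > K * bump l z x"
      by (simp only: nondiv_op_bump mult.commute)
  qed
qed

text \<open>At a minimum the gradient vanishes, so the drift drops out, and the trace of the product of two positive
  semidefinite matrices is nonnegative.\<close>

lemma op_nonneg_at_interior_min: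
  assumes U: "open U" "U \<subseteq> \<Omega>" "y \<in> U" and jet: "has_jet U v G H"
    and min: "\<And>x. x \<in> U \<Longrightarrow> v y \<le> v x"
  shows "L G H y \<ge> 0"
proof -
  have y\<Omega>: "y \<in> \<Omega>" using U by blast
  have "0 \<le> (\<Sum>i\<in>UNIV. \<Sum>j\<in>UNIV. A y $ i $ j * H y $ i $ j)"
  proof (rule psd_trace_nonneg)
    show "0 \<le> (\<Sum>i\<in>UNIV. \<Sum>j\<in>UNIV. A y $ i $ j * \<xi> $ i * \<xi> $ j)" for \<xi>
      using elliptic[OF y\<Omega>, of \<xi>] c_pos by (smt (verit) mult_nonneg_nonneg zero_le_power2)
  qed (use sym[OF y\<Omega>] interior_min_jet(2)[OF U(1,3) jet min] in auto)
  with interior_min_jet(1)[OF U(1,3) jet min] show ?thesis by (simp add: nondiv_op_def)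
qed

text \<open>A negative minimum would lie in the interior, where \<open>op_nonneg_at_interior_min\<close> contradicts the strict
  inequality. The inequality is only assumed where \<open>v\<close> is negative; this accommodates the zero-order terms
  that come from the nonlinearities.\<close>

lemma comparison_strict:
  assumes U: "open U" "U \<subseteq> \<Omega>" and cont: "continuous_on (closure U) v" and jet: "has_jet U v G H"
    and bd: "\<And>x. x \<in> frontier U \<Longrightarrow> v x \<ge> 0"
    and op: "\<And>x. x \<in> U \<Longrightarrow> v x < 0 \<Longrightarrow> L G H x < 0"
    and x: "x \<in> closure U"
  shows "v x \<ge> 0"
proof (rule ccontr)
  assume neg: "\<not> v x \<ge> 0"
  have "compact (closure U)"
    using bounded_closure[OF bounded_subset[OF bounded_dom U(2)]] by (simp add: compact_eq_bounded_closed)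
  moreover have "closure U \<noteq> {}" using x by auto
  ultimately obtain y where y: "y \<in> closure U" "\<And>q. q \<in> closure U \<Longrightarrow> v y \<le> v q"
    using continuous_attains_inf[OF _ _ cont] by blast
  have vy: "v y < 0" using y(2)[OF x] neg by simp
  then have yU: "y \<in> U" using bd[of y] y(1) U(1) by (force simp: frontier_def interior_open)
  have "v y \<le> v q" if "q \<in> U" for q using y(2) that closure_subset by blast
  then have "L G H y \<ge> 0" by (rule op_nonneg_at_interior_min[OF U yU jet])
  with op[OF yU vy] show False by simp
qed

text \<open>The weak inequality is made strict by subtracting a small multiple of a barrier centred far outside the
  domain, where \<open>L bump > 0\<close> everywhere.\<close>

lemma comparison:
  assumes cont: "continuous_on (closure \<Omega>) v" and jet: "has_jet \<Omega> v G H"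
    and bd: "\<And>x. x \<in> frontier \<Omega> \<Longrightarrow> v x \<ge> 0"
    and op: "\<And>x. x \<in> \<Omega> \<Longrightarrow> v x < 0 \<Longrightarrow> L G H x \<le> 0"
    and x: "x \<in> closure \<Omega>"
  shows "v x \<ge> 0"
proof (rule ccontr)
  assume neg: "\<not> v x \<ge> 0"
  define \<epsilon> where "\<epsilon> = - v x / 2"
  have e: "\<epsilon> > 0" using neg by (simp add: \<epsilon>_def)
  obtain M where M: "M > 0" "\<And>y. y \<in> \<Omega> \<Longrightarrow> norm y \<le> M"
    using bounded_dom by (auto simp: bounded_pos)
  obtain z :: "real^'n" where z: "norm z = M + 1" using vector_choose_size[of "M + 1"] M by auto
  obtain l where l: "l > 0"
    "\<And>y. y \<in> \<Omega> \<Longrightarrow> 1 \<le> norm (y - z) \<Longrightarrow> norm (y - z) \<le> 2 * M + 1 \<Longrightarrow>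
       L (bump_grad l z) (bump_hess l z) y > 0 * bump l z y"
    using bump_subsolution[of 1 0 z "2 * M + 1"] by auto
  have Lb: "L (bump_grad l z) (bump_hess l z) y > 0" if "y \<in> \<Omega>" for y
    using l(2)[OF that] M(2)[OF that] z norm_triangle_ineq4[of y z] norm_triangle_ineq2[of z y]
    by (simp add: norm_minus_commute)
  \<comment> \<open>Adding \<open>\<epsilon>\<close> keeps the boundary values nonnegative because \<open>bump \<le> 1\<close>; half of \<open>- v x\<close> is small
     enough for \<open>v'\<close> to stay negative at \<open>x\<close>.\<close>
  define v' where "v' y = 1 * v y + (-\<epsilon>) * bump l z y + \<epsilon>" for y
  have "v' x \<ge> 0"
  proof (rule comparison_strict[OF open_dom order_refl _ _ _ _ x])
    show "continuous_on (closure \<Omega>) v'"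
      unfolding v'_def by (intro continuous_intros cont continuous_on_bump)
    show "has_jet \<Omega> v' (\<lambda>y. 1 *\<^sub>R G y + (-\<epsilon>) *\<^sub>R bump_grad l z y) (\<lambda>y. 1 *\<^sub>R H y + (-\<epsilon>) *\<^sub>R bump_hess l z y)"
      unfolding v'_def by (rule has_jet_lincomb[OF jet bump_has_jet])
    have le: "\<epsilon> * bump l z y \<le> \<epsilon>" for y using bump_le_1[of l z y] l e by simp
    show "v' y \<ge> 0" if "y \<in> frontier \<Omega>" for y
      using bd[OF that] le[of y] by (simp add: v'_def)
    show "L (\<lambda>y. 1 *\<^sub>R G y + (-\<epsilon>) *\<^sub>R bump_grad l z y) (\<lambda>y. 1 *\<^sub>R H y + (-\<epsilon>) *\<^sub>R bump_hess l z y) y < 0"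
      if "y \<in> \<Omega>" "v' y < 0" for y
    proof -
      have "v y < 0" using that le[of y] by (simp add: v'_def)
      from op[OF that(1) this] mult_pos_pos[OF e Lb[OF that(1)]] show ?thesis
        unfolding nondiv_op_lincomb by linarith
    qed
  qed
  moreover have "\<epsilon> * bump l z x > 0" using e by (simp add: bump_pos)
  ultimately show False using neg unfolding v'_def \<epsilon>_def by linarith
qed

text \<open>Hopf's boundary point lemma, for all directions \<open>d\<close> that enter the touching ball and not only for the
  normal. In the annulus between the radii \<open>r / 2\<close> and \<open>r\<close>, \<open>w\<close> is at least a multiple of
  \<open>bump - e0\<close>, which vanishes on the outer sphere: on the inner sphere because \<open>w\<close> is bounded below
  there, on the outer one trivially, and in between by \<open>comparison_strict\<close>. The barrier itself grows
  linearly along \<open>d\<close>. Stating the growth of \<open>w\<close>, and not a derivative at \<open>p\<close>, makes the lemma usable both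
  at interior points and at boundary points.\<close>

lemma hopf_oblique:
  assumes cont: "continuous_on (closure \<Omega>) w" and nonneg: "\<And>x. x \<in> closure \<Omega> \<Longrightarrow> w x \<ge> 0"
    and jet: "has_jet \<Omega> w G H" and K: "K \<ge> 0"
    and super: "\<And>x. x \<in> \<Omega> \<Longrightarrow> L G H x \<le> K * w x"
    and ball: "r > 0" "ball z r \<subseteq> \<Omega>" and pos: "\<And>x. x \<in> ball z r \<Longrightarrow> w x > 0"
    and p: "norm (p - z) = r" and d: "d \<bullet> (z - p) > 0"
  obtains \<eta> where "\<eta> > 0" "\<forall>\<^sub>F t in at_right 0. \<eta> * t \<le> w (p + t *\<^sub>R d)"
proof -
  define U where "U = ball z r - cball z (r / 2)"
  have U: "open U" "U \<subseteq> \<Omega>" using ball by (auto simp: U_def)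
  have clU: "closure U \<subseteq> cball z r - ball z (r / 2)"
    by (rule closure_minimal) (auto simp: U_def intro: closed_Diff)
  have cb: "cball z r \<subseteq> closure \<Omega>" using closure_mono[OF ball(2)] ball(1) by simp
  have sph: "sphere z (r / 2) \<subseteq> ball z r" using ball(1) by auto
  obtain m where m: "m > 0" "\<And>x. x \<in> sphere z (r / 2) \<Longrightarrow> m \<le> w x"
  proof -
    have ne: "sphere z (r / 2) \<noteq> {}" using ball(1) by simp
    have "continuous_on (sphere z (r / 2)) w"
      by (rule continuous_on_subset[OF cont]) (use sph ball closure_subset in blast)
    from continuous_attains_inf[OF compact_sphere ne this] obtain y where
      "y \<in> sphere z (r / 2)" "\<And>x. x \<in> sphere z (r / 2) \<Longrightarrow> w y \<le> w x" by blast
    with pos[of y] sph that show thesis by blast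
  qed
  obtain l where l: "l > 0"
    "\<And>x. x \<in> \<Omega> \<Longrightarrow> r / 2 \<le> norm (x - z) \<Longrightarrow> norm (x - z) \<le> r \<Longrightarrow>
       L (bump_grad l z) (bump_hess l z) x > K * bump l z x"
    using bump_subsolution[of "r / 2" K z r] ball K by auto
  \<comment> \<open>\<open>e0\<close> is the value of the barrier on the outer sphere.\<close>
  define e0 where "e0 = exp (- l * r\<^sup>2)"
  define v where "v x = 1 * w x + (-m) * bump l z x + m * e0" for x
  have e0: "e0 > 0" by (simp add: e0_def)
  have v0: "v x \<ge> 0" if "x \<in> closure U" for x
  proof (rule comparison_strict[OF U _ _ _ _ that])
    have sub: "closure U \<subseteq> closure \<Omega>" by (rule closure_mono[OF U(2)])
    show "continuous_on (closure U) v"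
      unfolding v_def by (intro continuous_intros continuous_on_subset[OF cont sub] continuous_on_bump)
    show "has_jet U v (\<lambda>y. 1 *\<^sub>R G y + (-m) *\<^sub>R bump_grad l z y) (\<lambda>y. 1 *\<^sub>R H y + (-m) *\<^sub>R bump_hess l z y)"
      unfolding v_def by (rule has_jet_lincomb[OF has_jet_subset[OF jet U(2)] bump_has_jet])
    show "v y \<ge> 0" if "y \<in> frontier U" for y
    proof -
      have y: "y \<in> closure U" "y \<notin> U" using that U(1) by (auto simp: frontier_def interior_open)
      then have "norm (y - z) = r \<or> y \<in> sphere z (r / 2)"
        using clU by (auto simp: U_def dist_norm norm_minus_commute)
      then show ?thesis
      proof
        assume "norm (y - z) = r"
        then have "bump l z y = e0" by (simp add: bump_def e0_def dot_square_norm)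
        then show ?thesis using nonneg y sub by (auto simp: v_def)
      next
        assume "y \<in> sphere z (r / 2)"
        moreover have "m * bump l z y \<le> m" using bump_le_1[of l z y] l m(1) by simp
        ultimately show ?thesis using m(2)[of y] mult_pos_pos[OF m(1) e0] by (simp add: v_def)
      qed
    qed
    show "L (\<lambda>y. 1 *\<^sub>R G y + (-m) *\<^sub>R bump_grad l z y) (\<lambda>y. 1 *\<^sub>R H y + (-m) *\<^sub>R bump_hess l z y) y < 0"
      if "y \<in> U" "v y < 0" for y
    proof -
      have "L (bump_grad l z) (bump_hess l z) y > K * bump l z y"
        using l(2)[of y] that(1) subsetD[OF U(2) that(1)]
        by (auto simp: U_def dist_norm norm_minus_commute)
      then have "m * (K * bump l z y) < m * L (bump_grad l z) (bump_hess l z) y"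
        using m(1) by (intro mult_strict_left_mono)
      moreover have "L G H y \<le> K * w y" using super that U by blast
      moreover have "w y - m * bump l z y \<le> 0"
        using that(2) mult_pos_pos[OF m(1) e0] unfolding v_def by linarith
      then have "K * (w y - m * bump l z y) \<le> 0" by (rule mult_nonneg_nonpos[OF K])
      ultimately show ?thesis
        unfolding nondiv_op_lincomb by (simp add: algebra_simps)
    qed
  qed
  define \<sigma> where "\<sigma> = d \<bullet> (z - p)"
  have s: "\<sigma> > 0" using d by (simp add: \<sigma>_def)
  define \<eta> where "\<eta> = m * e0 * (l * \<sigma>)"
  have "\<eta> > 0" using m e0 l s by (simp add: \<eta>_def)
  moreover have "\<forall>\<^sub>F t in at_right 0. \<eta> * t \<le> w (p + t *\<^sub>R d)"
  proof -
    have "((\<lambda>t. norm (p + t *\<^sub>R d - z)) \<longlongrightarrow> norm (p + 0 *\<^sub>R d - z)) (at_right 0)"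
      by (intro tendsto_intros)
    then have "((\<lambda>t. norm (p + t *\<^sub>R d - z)) \<longlongrightarrow> r) (at_right 0)" using p by simp
    from order_tendstoD(1)[OF this, of "r / 2"] ball(1)
    have ev1: "\<forall>\<^sub>F t in at_right 0. r / 2 < norm (p + t *\<^sub>R d - z)" by simp
    show ?thesis
      using ev1 eventually_enters_ball[OF p d] eventually_at_right_less[of 0]
    proof eventually_elim
      case (elim t)
      have le: "(p + t *\<^sub>R d - z) \<bullet> (p + t *\<^sub>R d - z) \<le> r\<^sup>2 - t * \<sigma>"
        using elim by (simp add: \<sigma>_def)
      have "p + t *\<^sub>R d \<in> U" using elim by (simp add: U_def dist_norm norm_minus_commute)
      then have "v (p + t *\<^sub>R d) \<ge> 0" using v0 closure_subset by blast
      then have "w (p + t *\<^sub>R d) \<ge> m * (bump l z (p + t *\<^sub>R d) - e0)" by (simp add: v_def algebra_simps)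
      moreover have "bump l z (p + t *\<^sub>R d) \<ge> e0 * (1 + l * (t * \<sigma>))"
      proof -
        have "e0 * (1 + l * (t * \<sigma>)) \<le> e0 * exp (l * (t * \<sigma>))"
          using e0 by (intro mult_left_mono exp_ge_add_one_self) auto
        also have "\<dots> = exp (- l * (r\<^sup>2 - t * \<sigma>))"
          by (simp add: e0_def exp_add[symmetric] algebra_simps)
        also have "\<dots> \<le> bump l z (p + t *\<^sub>R d)"
          unfolding bump_def using le l(1) by simp
        finally show ?thesis .
      qed
      then have "m * (bump l z (p + t *\<^sub>R d) - e0) \<ge> m * (e0 * (l * (t * \<sigma>)))"
        using m(1) by (intro mult_left_mono) (auto simp: algebra_simps)
      ultimately show ?case by (simp add: \<eta>_def algebra_simps)
    qed
  qed
  ultimately show thesis by (rule that)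
qed

text \<open>The zero set of \<open>w\<close> is closed in the domain; it is also open. Otherwise some ball on which \<open>w > 0\<close>
  touches the zero set at an interior point \<open>p'\<close>. There \<open>w\<close> has a minimum, so its derivative vanishes,
  while Hopf's lemma makes \<open>w\<close> grow linearly into the ball.\<close>

lemma strong_minimum_principle:
  assumes conn: "connected \<Omega>"
    and cont: "continuous_on (closure \<Omega>) w" and nonneg: "\<And>x. x \<in> closure \<Omega> \<Longrightarrow> w x \<ge> 0"
    and jet: "has_jet \<Omega> w G H" and K: "K \<ge> 0"
    and super: "\<And>x. x \<in> \<Omega> \<Longrightarrow> L G H x \<le> K * w x"
    and q0: "q0 \<in> \<Omega>" "w q0 = 0" and x: "x \<in> \<Omega>"
  shows "w x = 0"
proof -
  define Z where "Z = {x \<in> \<Omega>. w x = 0}"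
  have sub: "\<Omega> \<subseteq> closure \<Omega>" by (rule closure_subset)
  have "closedin (top_of_set \<Omega>) Z"
    unfolding Z_def by (rule continuous_closedin_preimage_constant[OF continuous_on_subset[OF cont sub]])
  moreover have "open Z"
    unfolding open_contains_ball
  proof
    fix p assume p: "p \<in> Z"
    then obtain \<rho> where \<rho>: "\<rho> > 0" "ball p \<rho> \<subseteq> \<Omega>"
      using open_dom by (auto simp: Z_def open_contains_ball)
    have "w q = 0" if q: "dist p q < \<rho> / 2" for q
    proof (rule ccontr)
      assume "w q \<noteq> 0"
      have q\<Omega>: "q \<in> \<Omega>" using q \<rho> by auto
      then have wq: "w q > 0" using nonneg[of q] sub \<open>w q \<noteq> 0\<close> by fastforce
      \<comment> \<open>\<open>q\<close> lies within \<open>\<rho> / 2\<close> of \<open>p\<close>, so that this ball around \<open>q\<close> stays in the ball of radius \<open>\<rho>\<close> around \<open>p\<close>.\<close>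
      have cb: "cball q (dist q p) \<subseteq> \<Omega>"
      proof
        fix y assume "y \<in> cball q (dist q p)"
        then have "dist p y < \<rho>" using q dist_triangle[of p y q] by (simp add: dist_commute)
        then show "y \<in> \<Omega>" using \<rho> by auto
      qed
      define C where "C = {y \<in> cball q (dist q p). w y = 0}"
      have "closed C" unfolding C_def
        by (rule continuous_closed_preimage_constant[OF continuous_on_subset[OF cont]]) (use cb sub in auto)
      moreover have "p \<in> C" using p by (simp add: C_def Z_def)
      ultimately obtain p' where p': "p' \<in> C" "\<And>y. y \<in> C \<Longrightarrow> dist q p' \<le> dist q y"
        using distance_attains_inf[of C q] by blast
      define r where "r = dist q p'"
      have "p' \<noteq> q" using p' wq by (auto simp: C_def)
      then have r: "r > 0" by (simp add: r_def)
      have r_le: "r \<le> dist q p" using p' by (simp add: C_def r_def)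
      have bq: "ball q r \<subseteq> \<Omega>" using cb r_le by (meson ball_subset_cball order_trans subset_ball)
      have wpos: "w y > 0" if "y \<in> ball q r" for y
      proof (rule ccontr)
        assume "\<not> w y > 0"
        moreover have "y \<in> closure \<Omega>" using that bq sub by blast
        ultimately have "w y = 0" using nonneg[of y] by simp
        then have "y \<in> C" using that r_le by (simp add: C_def)
        then show False using p'(2)[of y] that by (simp add: r_def)
      qed
      have p'\<Omega>: "p' \<in> \<Omega>" and wp': "w p' = 0" using p' cb by (auto simp: C_def)
      have dpos: "(q - p') \<bullet> (q - p') > 0" using \<open>p' \<noteq> q\<close> by simp
      have nr: "norm (p' - q) = r" by (simp add: r_def dist_norm norm_minus_commute)
      obtain \<eta> where \<eta>: "\<eta> > 0" "\<forall>\<^sub>F t in at_right 0. \<eta> * t \<le> w (p' + t *\<^sub>R (q - p'))"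
        by (rule hopf_oblique[OF cont nonneg jet K super r bq wpos nr dpos])
      have "G p' = 0"
        by (rule interior_min_jet(1)[OF open_dom p'\<Omega> jet]) (use wp' nonneg sub in auto)
      then have "((\<lambda>t. w (p' + t *\<^sub>R (q - p'))) has_real_derivative 0) (at 0)"
        using has_jet_line(1)[OF jet, of p' 0 "q - p'" UNIV] p'\<Omega> by simp
      then have "((\<lambda>t. w (p' + t *\<^sub>R (q - p')) / t) \<longlongrightarrow> 0) (at 0)"
        by (simp add: DERIV_def wp')
      then have "((\<lambda>t. w (p' + t *\<^sub>R (q - p')) / t) \<longlongrightarrow> 0) (at_right 0)"
        by (rule tendsto_within_subset) simp
      from order_tendstoD(2)[OF this \<eta>(1)] \<eta>(2) eventually_at_right_less[of "0::real"]
      have "\<forall>\<^sub>F t::real in at_right 0. False"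
        by eventually_elim (auto simp: field_simps)
      then show False by simp
    qed
    then have "ball p (\<rho> / 2) \<subseteq> Z" using \<rho> by (auto simp: Z_def)
    then show "\<exists>e>0. ball p e \<subseteq> Z" using \<rho>(1) by (intro exI[of _ "\<rho> / 2"]) simp
  qed
  then have "openin (top_of_set \<Omega>) Z" by (intro open_openin_trans[OF open_dom]) (auto simp: Z_def)
  ultimately have "Z = {} \<or> Z = \<Omega>" using conn by (simp add: connected_clopen)
  then show ?thesis using q0 x by (auto simp: Z_def)
qed

end

section \<open>The interior ball condition\<close>

lemma Ck_closure_2_bounded:
  assumes "open \<Omega>" "bounded \<Omega>" "Ck_closure 2 \<Omega> f"
  obtains M where "M \<ge> 0" "\<And>x. x \<in> \<Omega> \<Longrightarrow> \<bar>f x\<bar> \<le> M"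
    "\<And>x i. x \<in> \<Omega> \<Longrightarrow> \<bar>partial_deriv i f x\<bar> \<le> M"
    "\<And>x i j. x \<in> \<Omega> \<Longrightarrow> \<bar>partial_deriv i (partial_deriv j f) x\<bar> \<le> M"
proof -
  have comp: "compact (closure \<Omega>)"
    using bounded_closure[OF assms(2)] by (simp add: compact_eq_bounded_closed)
  have bd: "\<exists>M. \<forall>x\<in>\<Omega>. \<bar>h x\<bar> \<le> M" if "continuous_on (closure \<Omega>) h" for h :: "real^'a \<Rightarrow> real"
    using compact_imp_bounded[OF compact_continuous_image[OF that comp]] closure_subset[of \<Omega>]
    unfolding bounded_iff by fastforce
  note C = Ck_closure_2D[OF assms(3)]
  obtain M0 where M0: "\<And>x. x \<in> \<Omega> \<Longrightarrow> \<bar>f x\<bar> \<le> M0" using bd[OF C(1)] by blast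
  have "\<forall>i. \<exists>M. \<forall>x\<in>\<Omega>. \<bar>partial_cl \<Omega> i f x\<bar> \<le> M" using bd[OF C(2)] by blast
  then obtain M1 where M1: "\<And>i x. x \<in> \<Omega> \<Longrightarrow> \<bar>partial_cl \<Omega> i f x\<bar> \<le> M1 i" by metis
  have "\<forall>i j. \<exists>M. \<forall>x\<in>\<Omega>. \<bar>partial_cl \<Omega> i (partial_cl \<Omega> j f) x\<bar> \<le> M" using bd[OF C(3)] by blast
  then obtain M2 where M2: "\<And>i j x. x \<in> \<Omega> \<Longrightarrow> \<bar>partial_cl \<Omega> i (partial_cl \<Omega> j f) x\<bar> \<le> M2 i j" by metis
  define M where "M = \<bar>M0\<bar> + (\<Sum>i\<in>UNIV. \<bar>M1 i\<bar>) + (\<Sum>i\<in>UNIV. \<Sum>j\<in>UNIV. \<bar>M2 i j\<bar>)"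
  have s1: "\<bar>M1 i\<bar> \<le> (\<Sum>i\<in>UNIV. \<bar>M1 i\<bar>)" for i by (rule member_le_sum) auto
  have s2: "\<bar>M2 i j\<bar> \<le> (\<Sum>i\<in>UNIV. \<Sum>j\<in>UNIV. \<bar>M2 i j\<bar>)" for i j
  proof -
    have "\<bar>M2 i j\<bar> \<le> (\<Sum>j\<in>UNIV. \<bar>M2 i j\<bar>)" by (rule member_le_sum) auto
    also have "\<dots> \<le> (\<Sum>i\<in>UNIV. \<Sum>j\<in>UNIV. \<bar>M2 i j\<bar>)" by (rule member_le_sum) (auto intro: sum_nonneg)
    finally show ?thesis .
  qed
  have nn: "(\<Sum>i\<in>UNIV. \<bar>M1 i\<bar>) \<ge> 0" "(\<Sum>i\<in>UNIV. \<Sum>j\<in>UNIV. \<bar>M2 i j\<bar>) \<ge> 0" by (auto intro!: sum_nonneg)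
  show thesis
  proof (rule that[of M])
    show "M \<ge> 0" using nn unfolding M_def by linarith
    fix x assume x: "x \<in> \<Omega>"
    show "\<bar>f x\<bar> \<le> M" using M0[OF x] nn unfolding M_def by linarith
    show "\<bar>partial_deriv i f x\<bar> \<le> M" for i
      using M1[OF x, of i] s1[of i] nn x unfolding M_def by (simp add: partial_cl_def)
    show "\<bar>partial_deriv i (partial_deriv j f) x\<bar> \<le> M" for i j
      using M2[OF x, of i j] s2[of i j] nn Ck_closure_2_partials(4)[OF assms(1,3) x, of i j]
      unfolding M_def by linarith
  qed
qed

text \<open>Taylor's formula of second order along segments, with the Hessian bounded on the ball.\<close>

lemma quadratic_upper_bound:
  fixes f :: "real^'n::finite \<Rightarrow> real"
  assumes C2: "Ck_closure 2 (ball y0 r) f" and r: "r > 0"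
  obtains C where "C \<ge> 0"
    "\<And>y. y \<in> ball y0 r \<Longrightarrow> f y \<le> f y0 + grad f y0 \<bullet> (y - y0) + C * (norm (y - y0))\<^sup>2"
proof -
  obtain M where M: "M \<ge> 0" "\<And>x i j. x \<in> ball y0 r \<Longrightarrow> \<bar>partial_deriv i (partial_deriv j f) x\<bar> \<le> M"
    by (rule Ck_closure_2_bounded[OF open_ball bounded_ball C2]) blast
  define C where "C = (\<Sum>i\<in>(UNIV::'n set). \<Sum>j\<in>(UNIV::'n set). M)"
  have jet: "has_jet (ball y0 r) f (grad f) (hess f)"
    by (rule Ck_closure_2_has_jet[OF open_ball C2])
  have Hbd: "\<xi> \<bullet> (hess f x *v \<xi>) \<le> C * (norm \<xi>)\<^sup>2" if "x \<in> ball y0 r" for x \<xi>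
  proof -
    have "\<xi> \<bullet> (hess f x *v \<xi>) = (\<Sum>i\<in>UNIV. \<Sum>j\<in>UNIV. \<xi> $ i * (hess f x $ i $ j * \<xi> $ j))"
      by (simp add: inner_vec_def matrix_vector_mult_def sum_distrib_left)
    also have "\<dots> \<le> (\<Sum>i\<in>(UNIV::'n set). \<Sum>j\<in>(UNIV::'n set). norm \<xi> * (M * norm \<xi>))"
    proof (intro sum_mono)
      fix i j
      have "\<xi> $ i * (hess f x $ i $ j * \<xi> $ j) \<le> \<bar>\<xi> $ i\<bar> * (\<bar>hess f x $ i $ j\<bar> * \<bar>\<xi> $ j\<bar>)"
        by (metis abs_ge_self abs_mult)
      also have "\<dots> \<le> norm \<xi> * (M * norm \<xi>)"
        using M that by (intro mult_mono component_le_norm_cart) (auto simp: hess_def)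
      finally show "\<xi> $ i * (hess f x $ i $ j * \<xi> $ j) \<le> norm \<xi> * (M * norm \<xi>)" .
    qed
    also have "\<dots> = C * (norm \<xi>)\<^sup>2" by (simp add: C_def power2_eq_square)
    finally show ?thesis .
  qed
  show thesis
  proof (rule that[of C])
    show "C \<ge> 0" using M(1) by (simp add: C_def)
    fix y assume y: "y \<in> ball y0 r"
    define \<xi> where "\<xi> = y - y0"
    have inb: "y0 + t *\<^sub>R \<xi> \<in> ball y0 r" if "0 \<le> t" "t \<le> 1" for t
    proof -
      have "t * norm \<xi> \<le> 1 * norm \<xi>" using that by (intro mult_right_mono) auto
      then show ?thesis using y that by (simp add: dist_norm \<xi>_def norm_minus_commute)
    qed
    define \<psi> where "\<psi> t = grad f (y0 + t *\<^sub>R \<xi>) \<bullet> \<xi>" for t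
    have "\<exists>s>0. s < 1 \<and> f (y0 + 1 *\<^sub>R \<xi>) - f (y0 + 0 *\<^sub>R \<xi>) = (1 - 0) * \<psi> s"
      unfolding \<psi>_def by (rule MVT2) (auto intro!: has_jet_line(1)[OF jet] inb)
    then obtain s where s: "0 < s" "s < 1" "f y - f y0 = \<psi> s" by (auto simp: \<xi>_def)
    have "\<exists>q>0. q < s \<and> \<psi> s - \<psi> 0 = (s - 0) * (\<xi> \<bullet> (hess f (y0 + q *\<^sub>R \<xi>) *v \<xi>))"
      unfolding \<psi>_def by (rule MVT2) (use s in \<open>auto intro!: has_jet_line(2)[OF jet] inb\<close>)
    then obtain q where q: "0 < q" "q < s" "\<psi> s - \<psi> 0 = s * (\<xi> \<bullet> (hess f (y0 + q *\<^sub>R \<xi>) *v \<xi>))" by auto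
    have "s * (\<xi> \<bullet> (hess f (y0 + q *\<^sub>R \<xi>) *v \<xi>)) \<le> s * (C * (norm \<xi>)\<^sup>2)"
      using Hbd[OF inb] q s by (intro mult_left_mono) auto
    also have "\<dots> \<le> 1 * (C * (norm \<xi>)\<^sup>2)"
      using s \<open>C \<ge> 0\<close> by (intro mult_right_mono) auto
    finally show "f y \<le> f y0 + grad f y0 \<bullet> (y - y0) + C * (norm (y - y0))\<^sup>2"
      using q(3) s(3) by (simp add: \<psi>_def \<xi>_def)
  qed
qed

text \<open>In the chart coordinates \<open>y = Q x\<close>, the quadratic bound places the domain above the paraboloid
  \<open>y $ m = \<gamma> y0 + g \<bullet> (y - y0) + C * (norm (y - y0))\<^sup>2\<close>, where \<open>g\<close> is the gradient of \<open>\<gamma>\<close> at \<open>y0\<close>.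
  A small ball that touches it at \<open>y0\<close> with normal direction \<open>e = axis m 1 - g\<close> lies above it. It
  remains to see that \<open>Q n\<close> is a negative multiple of \<open>e\<close>. The difference quotients along the curves in
  the graph over lines parallel to the axes show that \<open>Q n\<close> is orthogonal to the tangent space of the graph, hence
  a multiple of \<open>e\<close>; a positive multiple would make \<open>n\<close> point into the touching ball and thus into the
  domain.\<close>

lemma interior_ball_of_chart:
  fixes \<Omega> :: "(real^'n::finite) set"
  assumes op: "open \<Omega>" and chart: "boundary_chart 2 \<alpha> \<Omega> x0 r Q m \<gamma>"
    and x0: "x0 \<in> frontier \<Omega>" and n: "outward_unit_normal \<Omega> x0 n"
  obtains s where "s > 0" "ball (x0 - s *\<^sub>R n) s \<subseteq> \<Omega>"
proof -
  define y0 where "y0 = Q x0"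
  have r: "r > 0" and Q: "orthogonal_transformation Q"
    and indep: "\<And>y z. (\<And>i. i \<noteq> m \<Longrightarrow> y $ i = z $ i) \<Longrightarrow> \<gamma> y = \<gamma> z"
    and C2: "Ck_closure 2 (ball y0 r) \<gamma>"
    and \<Omega>_iff: "\<And>x. x \<in> ball x0 r \<Longrightarrow> x \<in> \<Omega> \<longleftrightarrow> Q x $ m > \<gamma> (Q x)"
    using chart unfolding boundary_chart_def Ck_holder_closure_def y0_def by blast+
  have linQ: "linear Q" and innQ: "\<And>v w. Q v \<bullet> Q w = v \<bullet> w"
    using Q by (auto simp: orthogonal_transformation_def)
  have normQ: "norm (Q v) = norm v" for v by (simp add: norm_eq_sqrt_inner innQ)
  have contQ: "continuous_on UNIV Q" by (rule linear_continuous_on[OF linear_conv_bounded_linear[THEN iffD1, OF linQ]])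
  obtain P where QP: "\<And>v. Q (P v) = v"
    using orthogonal_transformation_surj[OF Q] by (metis surjD)
  have normP: "norm (P v) = norm v" for v using normQ[of "P v"] by (simp add: QP)
  have distQ: "dist (Q x) y0 = dist x x0" for x
    unfolding y0_def dist_norm linear_diff[OF linQ, symmetric] by (rule normQ)
  define g where "g = grad \<gamma> y0"
  have contg: "continuous_on (ball y0 r) \<gamma>"
    using Ck_closure_2D(1)[OF C2] closure_subset by (rule continuous_on_subset)
  have gm: "g $ m = 0"
  proof -
    have "\<gamma> (y0 + t *\<^sub>R axis m 1) = \<gamma> y0" for t by (rule indep) (simp add: axis_def)
    then show ?thesis by (simp add: g_def grad_def partial_deriv_def)
  qed
  have x0n: "x0 \<notin> \<Omega>" and x0c: "x0 \<in> closure \<Omega>"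
    using x0 op by (auto simp: frontier_def interior_open)
  have y0m: "y0 $ m = \<gamma> y0"
  proof (rule antisym)
    show "y0 $ m \<le> \<gamma> y0" using \<Omega>_iff[of x0] x0n r by (simp add: y0_def)
    show "\<gamma> y0 \<le> y0 $ m"
    proof (rule ccontr)
      assume "\<not> \<gamma> y0 \<le> y0 $ m"
      define k where "k x = \<gamma> (Q x) - Q x $ m" for x
      have "continuous_on (ball x0 r) k"
        unfolding k_def
        by (intro continuous_intros continuous_on_compose2[OF contg] continuous_on_subset[OF contQ])
           (auto simp: distQ dist_commute[of x0] dist_commute[of y0])
      then have "open {x \<in> ball x0 r. k x > 0}"
        using continuous_open_preimage[of "ball x0 r" k "{0<..}"] by (simp add: vimage_def Int_def)
      moreover have "{x \<in> ball x0 r. k x > 0} \<inter> \<Omega> = {}" using \<Omega>_iff by (auto simp: k_def)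
      ultimately have "{x \<in> ball x0 r. k x > 0} \<inter> closure \<Omega> = {}" by (simp add: open_Int_closure_eq_empty)
      moreover have "x0 \<in> {x \<in> ball x0 r. k x > 0}"
        using r \<open>\<not> \<gamma> y0 \<le> y0 $ m\<close> by (simp add: k_def y0_def)
      ultimately show False using x0c by (meson disjoint_iff)
    qed
  qed
  obtain C where C: "C \<ge> 0"
    "\<And>y. y \<in> ball y0 r \<Longrightarrow> \<gamma> y \<le> \<gamma> y0 + g \<bullet> (y - y0) + C * (norm (y - y0))\<^sup>2"
    using quadratic_upper_bound[OF C2 r] unfolding g_def by metis
  define e where "e = axis m 1 - g"
  have em: "e $ m = 1" by (simp add: e_def gm)
  then have e0: "e \<noteq> 0" by auto
  define N where "N = e /\<^sub>R norm e"
  have normN: "norm N = 1" and eN: "e = norm e *\<^sub>R N" using e0 by (simp_all add: N_def)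
  \<comment> \<open>The first bound keeps the touching ball inside the chart, the second makes its curvature \<open>1 / s\<close> large
     compared with that of the paraboloid.\<close>
  define s where "s = min (r / 2) (norm e / (2 * (C + 1)))"
  have s: "s > 0" "2 * s \<le> r" using r e0 C(1) by (auto simp: s_def)
  have sC: "2 * s * C < norm e"
  proof -
    have "s * (2 * (C + 1)) \<le> norm e" using C(1) pos_le_divide_eq[of "2 * (C + 1)" s "norm e"] by (simp add: s_def)
    then show ?thesis using s by (simp add: algebra_simps)
  qed
  have ballN: "x \<in> \<Omega>" if x: "Q x \<in> ball (y0 + s *\<^sub>R N) s" for x
  proof -
    define \<xi> where "\<xi> = Q x - y0"
    have lt: "norm (\<xi> - s *\<^sub>R N) < s" using x by (simp add: dist_norm \<xi>_def norm_minus_commute algebra_simps)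
    have "norm \<xi> \<le> norm (\<xi> - s *\<^sub>R N) + norm (s *\<^sub>R N)" by (metis diff_add_cancel norm_triangle_ineq)
    then have "norm \<xi> < r" using lt s normN by simp
    then have xr: "x \<in> ball x0 r" "Q x \<in> ball y0 r"
      using distQ[of x] by (simp_all add: \<xi>_def dist_norm norm_minus_commute)
    have "(norm (\<xi> - s *\<^sub>R N))\<^sup>2 < s\<^sup>2" using lt by (intro power_strict_mono) auto
    moreover have "(norm (\<xi> - s *\<^sub>R N))\<^sup>2 = (norm \<xi>)\<^sup>2 - 2 * s * (N \<bullet> \<xi>) + s\<^sup>2 * (norm N)\<^sup>2"
      unfolding power2_norm_eq_inner by (simp add: inner_simps inner_commute power2_eq_square algebra_simps)
    ultimately have 1: "(norm \<xi>)\<^sup>2 < 2 * s * (N \<bullet> \<xi>)" using normN by simp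
    then have 2: "N \<bullet> \<xi> > 0" using s by (smt (verit) mult_nonneg_nonpos zero_le_power2)
    have "C * (norm \<xi>)\<^sup>2 \<le> C * (2 * s * (N \<bullet> \<xi>))" using 1 C(1) by (intro mult_left_mono) auto
    also have "\<dots> = (2 * s * C) * (N \<bullet> \<xi>)" by simp
    also have "\<dots> < norm e * (N \<bullet> \<xi>)" using sC 2 by (intro mult_strict_right_mono)
    finally have 3: "C * (norm \<xi>)\<^sup>2 < e \<bullet> \<xi>" by (subst eN) simp
    have "\<gamma> (Q x) \<le> \<gamma> y0 + g \<bullet> \<xi> + C * (norm \<xi>)\<^sup>2" using C(2)[OF xr(2)] by (simp add: \<xi>_def)
    also have "\<dots> < \<gamma> y0 + g \<bullet> \<xi> + e \<bullet> \<xi>" using 3 by simp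
    also have "\<dots> = Q x $ m" by (simp add: e_def inner_diff_left inner_axis' y0m[symmetric] \<xi>_def)
    finally show ?thesis using \<Omega>_iff[OF xr(1)] by simp
  qed
  define \<mu> where "\<mu> = Q n"
  have normn: "norm n = 1" and tang: "((\<lambda>y. ((y - x0) \<bullet> n) / norm (y - x0)) \<longlongrightarrow> 0) (at x0 within frontier \<Omega>)"
    and out: "\<forall>\<^sub>F t in at_right 0. x0 + t *\<^sub>R n \<notin> \<Omega>"
    using n by (auto simp: outward_unit_normal_def elim: eventually_mono)
  have normal: "\<mu> $ i + g $ i * \<mu> $ m = 0" if i: "i \<noteq> m" for i
  proof -
    define \<phi> where "\<phi> t = \<gamma> (y0 + t *\<^sub>R axis i 1) - \<gamma> y0" for t
    \<comment> \<open>\<open>y0 + D t\<close> runs in the graph over the line through \<open>y0\<close> parallel to the \<open>i\<close>-th axis, with initial velocity \<open>\<tau>\<close>.\<close>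
    define D where "D t = t *\<^sub>R axis i 1 + \<phi> t *\<^sub>R (axis m 1 :: real^'n)" for t
    define X where "X t = x0 + P (D t)" for t
    define \<tau> where "\<tau> = axis i 1 + g $ i *\<^sub>R (axis m 1 :: real^'n)"
    have QX: "Q (X t) = y0 + D t" for t by (simp add: X_def linear_add[OF linQ] QP y0_def)
    have "(\<phi> has_real_derivative g $ i) (at 0)"
    proof -
      have "has_partial i \<gamma> y0" using Ck_closure_2D(4)[OF C2] r by simp
      then show ?thesis unfolding \<phi>_def g_def grad_def has_partial_iff
        by (auto intro!: derivative_eq_intros)
    qed
    then have "((\<lambda>t. \<phi> t / t) \<longlongrightarrow> g $ i) (at 0)" by (simp add: DERIV_def \<phi>_def)
    then have phi: "((\<lambda>t. \<phi> t / t) \<longlongrightarrow> g $ i) (at_right 0)" by (rule tendsto_within_subset) simp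
    have Dt: "((\<lambda>t. D t /\<^sub>R t) \<longlongrightarrow> \<tau>) (at_right 0)"
    proof -
      have "((\<lambda>t. axis i 1 + (\<phi> t / t) *\<^sub>R axis m 1) \<longlongrightarrow> \<tau>) (at_right 0)"
        unfolding \<tau>_def by (intro tendsto_intros phi)
      moreover have "\<forall>\<^sub>F t in at_right 0. axis i 1 + (\<phi> t / t) *\<^sub>R axis m 1 = D t /\<^sub>R t"
        using eventually_at_right_less[of 0]
        by eventually_elim (simp add: D_def scaleR_add_right divide_inverse mult.commute)
      ultimately show ?thesis by (rule Lim_transform_eventually)
    qed
    have D0: "(D \<longlongrightarrow> 0) (at_right 0)"
    proof -
      have "((\<lambda>t. t *\<^sub>R (D t /\<^sub>R t)) \<longlongrightarrow> 0 *\<^sub>R \<tau>) (at_right 0)" by (intro tendsto_intros Dt)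
      moreover have "\<forall>\<^sub>F t in at_right (0::real). t *\<^sub>R (D t /\<^sub>R t) = D t"
        using eventually_at_right_less[of 0] by eventually_elim simp
      ultimately show ?thesis using Lim_transform_eventually by fastforce
    qed
    have near: "\<forall>\<^sub>F t in at_right 0. norm (D t) < r"
      using order_tendstoD(2)[OF tendsto_norm[OF D0], of r] r by simp
    have "\<forall>\<^sub>F t in at_right 0. X t \<in> frontier \<Omega> - {x0}"
      using near eventually_at_right_less[of 0]
    proof eventually_elim
      case (elim t)
      have Xr: "X t \<in> ball x0 r" using elim by (simp add: X_def dist_norm normP)
      have same: "\<gamma> (y0 + D t + q *\<^sub>R axis m 1) = (y0 + D t) $ m" for q
      proof -
        have "\<gamma> (y0 + D t + q *\<^sub>R axis m 1) = \<gamma> (y0 + t *\<^sub>R axis i 1)"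
          by (rule indep) (simp add: D_def axis_def)
        also have "\<dots> = (y0 + D t) $ m" using i by (simp add: D_def \<phi>_def y0m axis_def)
        finally show ?thesis .
      qed
      have "X t \<notin> \<Omega>" using \<Omega>_iff[OF Xr] same[of 0] by (simp add: QX)
      \<comment> \<open>Points of the graph are limits from above.\<close>
      moreover have "X t \<in> closure \<Omega>"
      proof -
        have lim: "((\<lambda>q. X t + q *\<^sub>R P (axis m 1)) \<longlongrightarrow> X t + 0 *\<^sub>R P (axis m 1)) (at_right 0)"
          by (intro tendsto_intros)
        then have "\<forall>\<^sub>F q in at_right 0. X t + q *\<^sub>R P (axis m 1) \<in> ball x0 r"
          using Xr by (intro topological_tendstoD[OF lim]) auto
        then have "\<forall>\<^sub>F q in at_right 0. X t + q *\<^sub>R P (axis m 1) \<in> closure \<Omega>"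
          using eventually_at_right_less[of 0]
        proof eventually_elim
          case (elim q)
          have "Q (X t + q *\<^sub>R P (axis m 1)) = y0 + D t + q *\<^sub>R axis m 1"
            by (simp add: linear_add[OF linQ] linear_cmul[OF linQ] QX QP)
          then have "X t + q *\<^sub>R P (axis m 1) \<in> \<Omega>"
            using \<Omega>_iff[OF elim(1)] same[of q] elim(2) by simp
          then show ?case using closure_subset by blast
        qed
        from Lim_in_closed_set[OF closed_closure this _ lim] show ?thesis by simp
      qed
      moreover have "X t \<noteq> x0"
      proof
        assume "X t = x0"
        then have "D t = 0" using QX[of t] by (simp add: y0_def)
        then have "D t $ i = 0" by simp
        then show False using elim i by (simp add: D_def axis_def)
      qed
      ultimately show ?case using op by (simp add: frontier_def interior_open)
    qed
    moreover have "(X \<longlongrightarrow> x0) (at_right 0)"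
    proof -
      have "((\<lambda>t. dist (X t) x0) \<longlongrightarrow> 0) (at_right 0)"
        using tendsto_norm[OF D0] by (simp add: X_def dist_norm normP)
      then show ?thesis by (rule tendsto_dist_iff[THEN iffD2])
    qed
    ultimately have limX: "filterlim X (at x0 within frontier \<Omega>) (at_right 0)"
      unfolding filterlim_at by (auto elim: eventually_mono)
    have "((\<lambda>t. (D t \<bullet> \<mu>) / norm (D t)) \<longlongrightarrow> 0) (at_right 0)"
    proof -
      have "(X t - x0) \<bullet> n = D t \<bullet> \<mu>" for t
        by (simp add: X_def \<mu>_def innQ[of "P (D t)" n, symmetric] QP)
      moreover have "norm (X t - x0) = norm (D t)" for t by (simp add: X_def normP)
      ultimately show ?thesis using filterlim_compose[OF tang limX] by simp
    qed
    from tendsto_mult[OF this tendsto_norm[OF Dt]]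
    have "((\<lambda>t. (D t \<bullet> \<mu>) / norm (D t) * norm (D t /\<^sub>R t)) \<longlongrightarrow> 0) (at_right 0)" by simp
    moreover have "\<forall>\<^sub>F t in at_right 0. (D t \<bullet> \<mu>) / norm (D t) * norm (D t /\<^sub>R t) = (D t /\<^sub>R t) \<bullet> \<mu>"
      using eventually_at_right_less[of 0]
    proof eventually_elim
      case (elim t)
      then have "norm (D t /\<^sub>R t) = norm (D t) * inverse t" by simp
      then show ?case by (cases "D t = 0") simp_all
    qed
    ultimately have "((\<lambda>t. (D t /\<^sub>R t) \<bullet> \<mu>) \<longlongrightarrow> 0) (at_right 0)" by (rule Lim_transform_eventually)
    moreover have "((\<lambda>t. (D t /\<^sub>R t) \<bullet> \<mu>) \<longlongrightarrow> \<tau> \<bullet> \<mu>) (at_right 0)" by (intro tendsto_intros Dt)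
    ultimately have "\<tau> \<bullet> \<mu> = 0" using tendsto_unique trivial_limit_at_right_real by blast
    then show ?thesis by (simp add: \<tau>_def inner_add_left inner_axis')
  qed
  have mu_e: "\<mu> = \<mu> $ m *\<^sub>R e"
  proof -
    have "\<mu> $ i = \<mu> $ m * e $ i" for i
      using normal[of i] em by (cases "i = m") (auto simp: e_def axis_def algebra_simps)
    then show ?thesis unfolding vec_eq_iff vector_scaleR_component real_scaleR_def by blast
  qed
  have mu_norm: "\<bar>\<mu> $ m\<bar> * norm e = 1"
    using arg_cong[OF mu_e, of norm] normQ[of n] normn by (simp add: \<mu>_def)
  have mu_N: "\<mu> = (\<mu> $ m * norm e) *\<^sub>R N" using mu_e eN by (metis scaleR_scaleR)
  have "\<mu> $ m < 0"
  proof (rule ccontr)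
    assume "\<not> \<mu> $ m < 0"
    then have "\<mu> $ m * norm e = 1" using mu_norm by simp
    then have "\<mu> = N" using mu_N by simp
    have "\<forall>\<^sub>F t in at_right 0. t < s" using eventually_at_right_real[OF s(1)] by (auto elim: eventually_mono)
    then have "\<forall>\<^sub>F t::real in at_right 0. False"
      using out eventually_at_right_less[of 0]
    proof eventually_elim
      case (elim t)
      have "Q (x0 + t *\<^sub>R n) = y0 + t *\<^sub>R N"
        by (simp add: linear_add[OF linQ] linear_cmul[OF linQ] y0_def \<mu>_def[symmetric] \<open>\<mu> = N\<close>)
      moreover have "dist (y0 + s *\<^sub>R N) (y0 + t *\<^sub>R N) < s"
        using elim normN by (simp add: dist_norm scaleR_diff_left[symmetric])
      ultimately show ?case using ballN[of "x0 + t *\<^sub>R n"] elim by simp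
    qed
    then show False by simp
  qed
  then have "\<mu> $ m * norm e = -1" using mu_norm by simp
  then have muN: "\<mu> = - N" using mu_N by simp
  have "ball (x0 - s *\<^sub>R n) s \<subseteq> \<Omega>"
  proof
    fix x assume x: "x \<in> ball (x0 - s *\<^sub>R n) s"
    have "Q (x0 - s *\<^sub>R n) = y0 + s *\<^sub>R N"
      using muN by (simp add: linear_diff[OF linQ] linear_cmul[OF linQ] y0_def \<mu>_def)
    then have "dist (y0 + s *\<^sub>R N) (Q x) = dist (x0 - s *\<^sub>R n) x"
      by (metis dist_norm linear_diff[OF linQ] normQ)
    then show "x \<in> \<Omega>" using x by (intro ballN) simp
  qed
  with s(1) show thesis by (rule that)
qed

section \<open>The nondivergence form of the operator\<close>

lemma has_partialI:
  assumes "((\<lambda>t. f (x + t *\<^sub>R axis i 1)) has_real_derivative d) (at 0)"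
  shows "has_partial i f x" "partial_deriv i f x = d"
  using assms DERIV_imp_deriv[OF assms]
  by (auto simp: has_partial_def partial_deriv_def field_differentiable_def)

lemma partial_mult:
  assumes "has_partial i f x" "has_partial i g x"
  shows "has_partial i (\<lambda>x. f x * g x) x"
    "partial_deriv i (\<lambda>x. f x * g x) x = partial_deriv i f x * g x + partial_deriv i g x * f x"
  using DERIV_mult[OF assms[unfolded has_partial_iff]]
  by (auto dest: has_partialI[where f = "\<lambda>x. f x * g x"])

lemma partial_add:
  assumes "has_partial i f x" "has_partial i g x"
  shows "has_partial i (\<lambda>x. f x + g x) x"
    "partial_deriv i (\<lambda>x. f x + g x) x = partial_deriv i f x + partial_deriv i g x"
  using DERIV_add[OF assms[unfolded has_partial_iff]]
  by (auto dest: has_partialI[where f = "\<lambda>x. f x + g x"])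

text \<open>A class of functions that is stable under sums and products, used to bound the drift coefficients.\<close>

definition bounded_C1 :: "(real^'n) set \<Rightarrow> (real^'n::finite \<Rightarrow> real) \<Rightarrow> bool" where
  "bounded_C1 S f \<longleftrightarrow> (\<exists>M\<ge>0. \<forall>x\<in>S. \<bar>f x\<bar> \<le> M \<and> (\<forall>i. has_partial i f x \<and> \<bar>partial_deriv i f x\<bar> \<le> M))"

lemma bounded_C1_const: "bounded_C1 S (\<lambda>_. k)"
proof -
  have "has_partial i (\<lambda>_. k) x \<and> partial_deriv i (\<lambda>_. k) x = 0" for i :: 'a and x
    using has_partialI[of "\<lambda>_. k" x i 0] by simp
  then show ?thesis unfolding bounded_C1_def by (intro exI[of _ "\<bar>k\<bar>"]) auto
qed

lemma bounded_C1_add: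
  assumes "bounded_C1 S f" "bounded_C1 S g"
  shows "bounded_C1 S (\<lambda>x. f x + g x)"
proof -
  obtain M where M: "M \<ge> 0" "\<And>x. x \<in> S \<Longrightarrow> \<bar>f x\<bar> \<le> M" "\<And>x i. x \<in> S \<Longrightarrow> has_partial i f x"
    "\<And>x i. x \<in> S \<Longrightarrow> \<bar>partial_deriv i f x\<bar> \<le> M" using assms(1) by (auto simp: bounded_C1_def)
  obtain N where N: "N \<ge> 0" "\<And>x. x \<in> S \<Longrightarrow> \<bar>g x\<bar> \<le> N" "\<And>x i. x \<in> S \<Longrightarrow> has_partial i g x"
    "\<And>x i. x \<in> S \<Longrightarrow> \<bar>partial_deriv i g x\<bar> \<le> N" using assms(2) by (auto simp: bounded_C1_def)
  have "\<bar>f x + g x\<bar> \<le> M + N" if "x \<in> S" for x using M(2)[OF that] N(2)[OF that] by linarith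
  moreover have "\<bar>partial_deriv i f x + partial_deriv i g x\<bar> \<le> M + N" if "x \<in> S" for x i
    using M(4)[OF that, of i] N(4)[OF that, of i] by linarith
  ultimately show ?thesis
    unfolding bounded_C1_def using M N by (intro exI[of _ "M + N"]) (auto simp: partial_add)
qed

lemma bounded_C1_mult:
  assumes "bounded_C1 S f" "bounded_C1 S g"
  shows "bounded_C1 S (\<lambda>x. f x * g x)"
proof -
  obtain M where M: "M \<ge> 0" "\<And>x. x \<in> S \<Longrightarrow> \<bar>f x\<bar> \<le> M" "\<And>x i. x \<in> S \<Longrightarrow> has_partial i f x"
    "\<And>x i. x \<in> S \<Longrightarrow> \<bar>partial_deriv i f x\<bar> \<le> M" using assms(1) by (auto simp: bounded_C1_def)
  obtain N where N: "N \<ge> 0" "\<And>x. x \<in> S \<Longrightarrow> \<bar>g x\<bar> \<le> N" "\<And>x i. x \<in> S \<Longrightarrow> has_partial i g x"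
    "\<And>x i. x \<in> S \<Longrightarrow> \<bar>partial_deriv i g x\<bar> \<le> N" using assms(2) by (auto simp: bounded_C1_def)
  have MN: "M * N \<ge> 0" using M(1) N(1) by simp
  have "\<bar>f x * g x\<bar> \<le> 2 * (M * N)" if "x \<in> S" for x
    using mult_mono[OF M(2)[OF that] N(2)[OF that]] M(1) MN by (simp add: abs_mult)
  moreover have "\<bar>partial_deriv i f x * g x + partial_deriv i g x * f x\<bar> \<le> 2 * (M * N)" if "x \<in> S" for x i
  proof -
    have "\<bar>partial_deriv i f x * g x\<bar> \<le> M * N"
      using mult_mono[OF M(4)[OF that, of i] N(2)[OF that]] M(1) by (simp add: abs_mult)
    moreover have "\<bar>partial_deriv i g x * f x\<bar> \<le> N * M"
      using mult_mono[OF N(4)[OF that, of i] M(2)[OF that]] N(1) by (simp add: abs_mult)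
    ultimately show ?thesis by (simp add: mult.commute)
  qed
  ultimately show ?thesis
    unfolding bounded_C1_def using M N MN by (intro exI[of _ "2 * (M * N)"]) (auto simp: partial_mult)
qed

lemma bounded_C1_sum:
  "(\<And>k. k \<in> I \<Longrightarrow> bounded_C1 S (f k)) \<Longrightarrow> bounded_C1 S (\<lambda>x. \<Sum>k\<in>I. f k x)"
  by (induction I rule: infinite_finite_induct) (auto intro: bounded_C1_const bounded_C1_add)

lemma bounded_C1_prod:
  "(\<And>k. k \<in> I \<Longrightarrow> bounded_C1 S (f k)) \<Longrightarrow> bounded_C1 S (\<lambda>x. \<Prod>k\<in>I. f k x)"
  by (induction I rule: infinite_finite_induct) (auto intro: bounded_C1_const bounded_C1_mult)

lemma bounded_C1_det:
  fixes a :: "real^'n::finite \<Rightarrow> real^'m^'m"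
  assumes "\<And>i j. bounded_C1 S (\<lambda>x. a x $ i $ j)"
  shows "bounded_C1 S (\<lambda>x. det (a x))"
  unfolding det_def
  by (intro bounded_C1_sum bounded_C1_mult[OF bounded_C1_const] bounded_C1_prod assms)

lemma bounded_C1_abs_powr:
  assumes f: "bounded_C1 S f" and low: "k > 0" "\<And>x. x \<in> S \<Longrightarrow> k \<le> \<bar>f x\<bar>" and p: "p < 0"
  shows "bounded_C1 S (\<lambda>x. \<bar>f x\<bar> powr p)"
proof -
  obtain M where M: "M \<ge> 0" "\<And>x i. x \<in> S \<Longrightarrow> has_partial i f x"
    "\<And>x i. x \<in> S \<Longrightarrow> \<bar>partial_deriv i f x\<bar> \<le> M" using f by (auto simp: bounded_C1_def)
  define N where "N = k powr p + \<bar>p\<bar> * k powr (p - 1) * M"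
  have N: "N \<ge> k powr p" "N \<ge> \<bar>p\<bar> * k powr (p - 1) * M" "N \<ge> 0" using M(1) by (simp_all add: N_def)
  have "\<bar>\<bar>f x\<bar> powr p\<bar> \<le> N \<and> (\<forall>i. has_partial i (\<lambda>x. \<bar>f x\<bar> powr p) x \<and> \<bar>partial_deriv i (\<lambda>x. \<bar>f x\<bar> powr p) x\<bar> \<le> N)"
    if x: "x \<in> S" for x
  proof (intro conjI allI)
    have fx: "f x \<noteq> 0" using low(1) low(2)[OF x] by auto
    have mono: "\<bar>f x\<bar> powr q \<le> k powr q" if "q < 0" for q
      using powr_mono2'[of "q" k "\<bar>f x\<bar>"] low(1) low(2)[OF x] that by simp
    show "\<bar>\<bar>f x\<bar> powr p\<bar> \<le> N" using mono[OF p] N(1) by simp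
    fix i
    have d: "((\<lambda>t. f (x + t *\<^sub>R axis i 1)) has_real_derivative partial_deriv i f x) (at 0)"
      using M(2)[OF x, of i] by (simp add: has_partial_iff)
    have "((\<lambda>s. \<bar>s\<bar> powr p) has_real_derivative p * \<bar>s\<bar> powr (p - 1) * sgn s) (at s)" if "s \<noteq> 0" for s :: real
    proof -
      have "\<forall>\<^sub>F r in nhds s. sgn s * r = \<bar>r\<bar>"
      proof (cases "s > 0")
        case True
        with eventually_nhds_in_open[of "{0<..}" s] show ?thesis by (auto elim!: eventually_mono)
      next
        case False
        with that have "s < 0" by simp
        with eventually_nhds_in_open[of "{..<0}" s] show ?thesis by (auto elim!: eventually_mono)
      qed
      moreover have "((\<lambda>r. sgn s * r) has_real_derivative sgn s) (at s)"
        by (auto intro!: derivative_eq_intros)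
      ultimately have "((\<lambda>r. \<bar>r\<bar>) has_real_derivative sgn s) (at s)"
        using DERIV_cong_ev[OF refl _ refl] by blast
      from DERIV_fun_powr[OF this] that show ?thesis by simp
    qed
    from DERIV_chain2[OF this d] fx
    have D: "((\<lambda>t. \<bar>f (x + t *\<^sub>R axis i 1)\<bar> powr p) has_real_derivative
        p * \<bar>f x\<bar> powr (p - 1) * sgn (f x) * partial_deriv i f x) (at 0)" by simp
    have "\<bar>p * \<bar>f x\<bar> powr (p - 1) * sgn (f x) * partial_deriv i f x\<bar>
        = \<bar>p\<bar> * \<bar>f x\<bar> powr (p - 1) * \<bar>partial_deriv i f x\<bar>" using fx by (simp add: abs_mult abs_sgn_eq)
    also have "\<dots> \<le> \<bar>p\<bar> * k powr (p - 1) * M"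
      using mono[of "p - 1"] p M(1) M(3)[OF x, of i] by (intro mult_mono mult_nonneg_nonneg) auto
    also have "\<dots> \<le> N" by (rule N(2))
    finally show "has_partial i (\<lambda>x. \<bar>f x\<bar> powr p) x" "\<bar>partial_deriv i (\<lambda>x. \<bar>f x\<bar> powr p) x\<bar> \<le> N"
      using has_partialI[of "\<lambda>x. \<bar>f x\<bar> powr p", OF D] by simp_all
  qed
  with N(3) show ?thesis unfolding bounded_C1_def by blast
qed

lemma Ck_closure_2_bounded_C1:
  assumes "open \<Omega>" "bounded \<Omega>" "Ck_closure 2 \<Omega> f"
  shows "bounded_C1 \<Omega> f"
proof -
  obtain M where "M \<ge> 0" "\<And>x. x \<in> \<Omega> \<Longrightarrow> \<bar>f x\<bar> \<le> M" "\<And>x i. x \<in> \<Omega> \<Longrightarrow> \<bar>partial_deriv i f x\<bar> \<le> M"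
    by (rule Ck_closure_2_bounded[OF assms]) blast
  then show ?thesis using Ck_closure_2D(4)[OF assms(3)] by (auto simp: bounded_C1_def)
qed

lemma det_nonzero_if_elliptic:
  fixes A :: "real^'n^'n::finite"
  assumes "c > 0" "\<And>\<xi>::real^'n. c * (norm \<xi>)\<^sup>2 \<le> (\<Sum>i\<in>UNIV. \<Sum>j\<in>UNIV. A $ i $ j * \<xi> $ i * \<xi> $ j)"
  shows "det A \<noteq> 0"
proof -
  have "\<xi> = 0" if "A *v \<xi> = 0" for \<xi>
  proof -
    have "(\<Sum>i\<in>UNIV. \<Sum>j\<in>UNIV. A $ i $ j * \<xi> $ i * \<xi> $ j) = \<xi> \<bullet> (A *v \<xi>)"
      by (simp add: inner_vec_def matrix_vector_mult_def sum_distrib_left mult_ac)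
    with assms(2)[of \<xi>] that have "c * (norm \<xi>)\<^sup>2 \<le> 0" by simp
    then have "(norm \<xi>)\<^sup>2 \<le> 0" using assms(1) by (simp add: mult_le_0_iff)
    then show ?thesis by simp
  qed
  then have "\<exists>B. B ** A = mat 1" using matrix_left_invertible_ker[of A] by simp
  then show ?thesis using invertible_left_inverse[of A] invertible_det_nz[of A] by blast
qed

text \<open>The product rule, applied to \<open>(|a| powr (-1/2) * a\<^sub>i\<^sub>j) * \<partial>\<^sub>j u\<close>. The weight cancels in the leading
  term. The drift coefficients contain only first derivatives of the coefficients and the factors
  \<open>|a| powr (1/2)\<close> and \<open>|a| powr (-1/2)\<close>, all bounded since the determinant is bounded away from
  zero on the compact closure.\<close>

lemma elliptic_op_nondivergence:
  fixes \<Omega> :: "(real^'n::finite) set"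
  assumes op: "open \<Omega>" and bd: "bounded \<Omega>" and c: "c > 0"
    and a_C2: "\<forall>i j. Ck_closure 2 \<Omega> (\<lambda>x. a x $ i $ j)"
    and a_sym: "\<forall>x\<in>closure \<Omega>. \<forall>i j. a x $ i $ j = a x $ j $ i"
    and a_elliptic: "\<forall>x\<in>closure \<Omega>. \<forall>\<xi>::real^'n.
           (\<Sum>i\<in>UNIV. \<Sum>j\<in>UNIV. a x $ i $ j * \<xi> $ i * \<xi> $ j) \<ge> c * (norm \<xi>)\<^sup>2"
  obtains b T B where "elliptic_operator \<Omega> a b c T B"
    "\<And>u x. Ck_closure 2 \<Omega> u \<Longrightarrow> x \<in> \<Omega> \<Longrightarrow> elliptic_op a u x = - nondiv_op a b (grad u) (hess u) x"
proof -
  have sub: "\<Omega> \<subseteq> closure \<Omega>" by (rule closure_subset)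
  have a1: "bounded_C1 \<Omega> (\<lambda>x. a x $ i $ j)" for i j
    using Ck_closure_2_bounded_C1[OF op bd] a_C2 by blast
  have det1: "bounded_C1 \<Omega> (\<lambda>x. det (a x))" by (rule bounded_C1_det[OF a1])
  have nz: "det (a x) \<noteq> 0" if "x \<in> closure \<Omega>" for x
    using det_nonzero_if_elliptic[OF c] a_elliptic that by blast
  obtain k where k: "k > 0" "\<And>x. x \<in> \<Omega> \<Longrightarrow> k \<le> \<bar>det (a x)\<bar>"
  proof (cases "\<Omega> = {}")
    case True
    then show thesis using that[of 1] by simp
  next
    case False
    have "continuous_on (closure \<Omega>) (\<lambda>x. a x $ i $ j)" for i j
      using Ck_closure_2D(1) a_C2 by blast
    then have cont: "continuous_on (closure \<Omega>) (\<lambda>x. \<bar>det (a x)\<bar>)"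
      unfolding det_def
      by (intro continuous_on_rabs continuous_on_sum continuous_on_mult continuous_on_const continuous_on_prod)
    have comp: "compact (closure \<Omega>)"
      using bounded_closure[OF bd] by (simp add: compact_eq_bounded_closed)
    have "closure \<Omega> \<noteq> {}" using False by simp
    from continuous_attains_inf[OF comp this cont] obtain y where "y \<in> closure \<Omega>" "\<And>x. x \<in> closure \<Omega> \<Longrightarrow> \<bar>det (a y)\<bar> \<le> \<bar>det (a x)\<bar>"
      by blast
    then show thesis using that[of "\<bar>det (a y)\<bar>"] nz[of y] sub by auto
  qed
  define q where "q i j x = \<bar>det (a x)\<bar> powr (- 1/2) * a x $ i $ j" for i j x
  have q1: "bounded_C1 \<Omega> (q i j)" for i j
    unfolding q_def by (intro bounded_C1_mult bounded_C1_abs_powr[OF det1 k] a1) auto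
  define b where "b x = (\<chi> j. \<Sum>i\<in>UNIV. \<bar>det (a x)\<bar> powr (1/2) * partial_deriv i (q i j) x)" for x
  obtain MD where MD: "\<And>x. x \<in> \<Omega> \<Longrightarrow> \<bar>det (a x)\<bar> \<le> MD" using det1 by (auto simp: bounded_C1_def)
  have "\<forall>i j. \<exists>M\<ge>0. \<forall>x\<in>\<Omega>. \<bar>a x $ i $ j\<bar> \<le> M"
    using a1 unfolding bounded_C1_def by meson
  then obtain MA where MA: "\<And>i j x. x \<in> \<Omega> \<Longrightarrow> \<bar>a x $ i $ j\<bar> \<le> MA i j" by metis
  have "\<forall>i j. \<exists>M\<ge>0. \<forall>x\<in>\<Omega>. \<bar>partial_deriv i (q i j) x\<bar> \<le> M" using q1 unfolding bounded_C1_def by meson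
  then obtain MQ where MQ: "\<And>i j x. x \<in> \<Omega> \<Longrightarrow> \<bar>partial_deriv i (q i j) x\<bar> \<le> MQ i j" by metis
  define T where "T = (\<Sum>i\<in>UNIV. MA i i)"
  define B where "B = (\<Sum>j\<in>UNIV. \<Sum>i\<in>UNIV. MD powr (1/2) * MQ i j)"
  show thesis
  proof (rule that[of b T B])
    show "elliptic_operator \<Omega> a b c T B"
    proof
      fix x :: "real^'n" and i j assume x: "x \<in> \<Omega>"
      then have xc: "x \<in> closure \<Omega>" using sub by blast
      show "a x $ i $ j = a x $ j $ i" using a_sym xc by blast
      show "c * (norm \<xi>)\<^sup>2 \<le> (\<Sum>i\<in>UNIV. \<Sum>j\<in>UNIV. a x $ i $ j * \<xi> $ i * \<xi> $ j)" for \<xi>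
        using a_elliptic xc by blast
      show "(\<Sum>i\<in>UNIV. a x $ i $ i) \<le> T"
        unfolding T_def by (intro sum_mono) (use MA[OF x] abs_le_D1 in blast)
      have "norm (b x) \<le> (\<Sum>j\<in>UNIV. \<bar>b x $ j\<bar>)" by (rule norm_le_l1_cart)
      also have "\<dots> \<le> B"
        unfolding B_def
      proof (rule sum_mono)
        fix j
        have "\<bar>b x $ j\<bar> \<le> (\<Sum>i\<in>UNIV. \<bar>\<bar>det (a x)\<bar> powr (1/2) * partial_deriv i (q i j) x\<bar>)"
          unfolding b_def by simp
        also have "\<dots> \<le> (\<Sum>i\<in>UNIV. MD powr (1/2) * MQ i j)"
          unfolding abs_mult using MD[OF x] MQ[OF x]
          by (intro sum_mono mult_mono) (auto intro: powr_mono2)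
        finally show "\<bar>b x $ j\<bar> \<le> (\<Sum>i\<in>UNIV. MD powr (1/2) * MQ i j)" .
      qed
      finally show "norm (b x) \<le> B" .
    qed (use op bd c in auto)
    fix u x assume u: "Ck_closure 2 \<Omega> u" and x: "x \<in> \<Omega>"
    define w where "w = \<bar>det (a x)\<bar> powr (1/2)"
    have w: "w * \<bar>det (a x)\<bar> powr (- 1/2) = 1"
      using nz[of x] x sub by (auto simp: w_def powr_add[symmetric])
    have "elliptic_op a u x = - w * (\<Sum>i\<in>UNIV. \<Sum>j\<in>UNIV. partial_deriv i (\<lambda>y. q i j y * partial_deriv j u y) x)"
      by (simp add: elliptic_op_def w_def q_def)
    also have "\<dots> = - (\<Sum>i\<in>UNIV. \<Sum>j\<in>UNIV. w * partial_deriv i (q i j) x * partial_deriv j u x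
         + a x $ i $ j * partial_deriv i (partial_deriv j u) x)"
    proof -
      have "w * partial_deriv i (\<lambda>y. q i j y * partial_deriv j u y) x
        = w * partial_deriv i (q i j) x * partial_deriv j u x + a x $ i $ j * partial_deriv i (partial_deriv j u) x" for i j
      proof -
        have "has_partial i (q i j) x" using q1 x unfolding bounded_C1_def by blast
        from partial_mult(2)[OF this Ck_closure_2_partials(3)[OF op u x]]
        have "w * partial_deriv i (\<lambda>y. q i j y * partial_deriv j u y) x
           = w * partial_deriv i (q i j) x * partial_deriv j u x
             + (w * \<bar>det (a x)\<bar> powr (- 1/2)) * a x $ i $ j * partial_deriv i (partial_deriv j u) x"
          by (simp add: q_def algebra_simps)
        then show ?thesis unfolding w by simp
      qed
      then show ?thesis by (simp only: mult_minus_left sum_distrib_left sum_negf)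
    qed
    also have "(\<Sum>i\<in>UNIV. \<Sum>j\<in>UNIV. w * partial_deriv i (q i j) x * partial_deriv j u x
         + a x $ i $ j * partial_deriv i (partial_deriv j u) x)
      = (\<Sum>j\<in>UNIV. \<Sum>i\<in>UNIV. w * partial_deriv i (q i j) x * partial_deriv j u x)
        + (\<Sum>j\<in>UNIV. \<Sum>i\<in>UNIV. a x $ i $ j * partial_deriv i (partial_deriv j u) x)"
      by (subst sum.swap) (simp add: sum.distrib)
    also have "(\<Sum>j\<in>UNIV. \<Sum>i\<in>UNIV. w * partial_deriv i (q i j) x * partial_deriv j u x) = b x \<bullet> grad u x"
      by (simp add: b_def grad_def inner_vec_def w_def sum_distrib_right)
    also have "(\<Sum>j\<in>UNIV. \<Sum>i\<in>UNIV. a x $ i $ j * partial_deriv i (partial_deriv j u) x)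
      = (\<Sum>j\<in>UNIV. \<Sum>i\<in>UNIV. a x $ j $ i * hess u x $ j $ i)"
    proof (intro sum.cong refl)
      fix i j
      have "a x $ i $ j = a x $ j $ i" using a_sym x sub by blast
      then show "a x $ i $ j * partial_deriv i (partial_deriv j u) x = a x $ j $ i * hess u x $ j $ i"
        by (simp add: hess_def)
    qed
    finally show "elliptic_op a u x = - nondiv_op a b (grad u) (hess u) x"
      by (simp add: nondiv_op_def)
  qed
qed

section \<open>Analytic and twice differentiable nonlinearities\<close>

text \<open>A nonzero power series is \<open>h ^ n\<close> times a series with nonzero constant term, so it does not vanish at
  small \<open>h \<noteq> 0\<close>.\<close>

lemma real_fps_zero_or_isolated_zero:
  fixes f :: "real \<Rightarrow> real"
  assumes "(\<lambda>h. f (x + h)) has_fps_expansion P"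
  shows "(\<forall>\<^sub>F y in nhds x. f y = 0) \<or> (\<forall>\<^sub>F y in at x. f y \<noteq> 0)"
proof -
  have ev: "\<forall>\<^sub>F h in nhds 0. eval_fps P h = f (x + h)" and rad: "fps_conv_radius P > 0"
    using assms by (auto simp: has_fps_expansion_def)
  have shift: "(\<forall>\<^sub>F y in nhds x. p y) \<longleftrightarrow> (\<forall>\<^sub>F h in nhds 0. p (x + h))" for p :: "real \<Rightarrow> bool"
  proof -
    have "nhds x = filtermap (\<lambda>h. x + h) (nhds 0)"
      using filtermap_nhds_shift[of "- x" 0] by (simp add: add.commute)
    then show ?thesis by (simp only: eventually_filtermap)
  qed
  show ?thesis
  proof (cases "P = 0")
    case True
    with ev have "\<forall>\<^sub>F h in nhds 0. f (x + h) = 0" by (auto elim: eventually_mono)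
    then show ?thesis by (simp add: shift)
  next
    case False
    define n where "n = subdegree P"
    define Q where "Q = fps_shift n P"
    have PQ: "P = Q * fps_X ^ n" unfolding Q_def n_def by (rule subdegree_decompose)
    have Q0: "eval_fps Q 0 \<noteq> 0" using False by (simp add: eval_fps_at_0 Q_def n_def)
    have radQ: "fps_conv_radius Q > 0" using rad by (simp add: Q_def)
    have "isCont (eval_fps Q) 0"
      using continuous_eval_fps[of 0 Q] radQ by (simp add: zero_ereal_def)
    then have "(eval_fps Q \<longlongrightarrow> eval_fps Q 0) (nhds 0)" by (simp add: isCont_def tendsto_nhds_iff)
    then have evQ: "\<forall>\<^sub>F h in nhds 0. eval_fps Q h \<noteq> 0" by (rule tendsto_imp_eventually_ne[OF _ Q0])
    have "\<forall>\<^sub>F h in nhds (0::real). ereal (norm h) < fps_conv_radius Q"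
      using eventually_nhds_in_open[OF open_eball, of "0::real" 0 "fps_conv_radius Q"] radQ
      by (simp add: zero_ereal_def)
    with ev evQ have "\<forall>\<^sub>F h in nhds 0. h \<noteq> 0 \<longrightarrow> f (x + h) \<noteq> 0"
    proof eventually_elim
      case (elim h)
      have "f (x + h) = eval_fps Q h * h ^ n"
        using elim(1,3) by (simp add: PQ eval_fps_mult)
      then show ?case using elim(2) by simp
    qed
    then have "\<forall>\<^sub>F y in nhds x. y \<noteq> x \<longrightarrow> f y \<noteq> 0" by (simp add: shift)
    then show ?thesis by (simp add: eventually_at_filter)
  qed
qed

text \<open>The set of points near which \<open>F\<close> vanishes identically is open by definition, and so is its complement,
  because at every other point the zeros do not accumulate.\<close>

lemma real_analytic_identity:
  assumes an: "real_analytic F" and zero: "\<forall>\<^sub>F y in nhds a. F y = 0"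
  shows "F x = 0"
proof -
  define Z where "Z = {x. \<forall>\<^sub>F y in nhds x. F y = 0}"
  have alt: "(\<forall>\<^sub>F y in nhds x. F y = 0) \<or> (\<forall>\<^sub>F y in at x. F y \<noteq> 0)" for x
    using an real_fps_zero_or_isolated_zero unfolding real_analytic_def by blast
  have "open Z"
    unfolding open_subopen[of Z]
  proof
    fix x assume "x \<in> Z"
    then obtain T where T: "open T" "x \<in> T" "\<And>y. y \<in> T \<Longrightarrow> F y = 0"
      unfolding Z_def eventually_nhds by blast
    then show "\<exists>T. open T \<and> x \<in> T \<and> T \<subseteq> Z" unfolding Z_def eventually_nhds by blast
  qed
  moreover have "open (- Z)"
    unfolding open_subopen[of "- Z"]
  proof
    fix x assume x: "x \<in> - Z"
    then have "\<forall>\<^sub>F y in at x. F y \<noteq> 0" using alt[of x] by (simp add: Z_def)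
    then obtain T where T: "open T" "x \<in> T" "\<And>y. y \<in> T \<Longrightarrow> y \<noteq> x \<Longrightarrow> F y \<noteq> 0"
      unfolding eventually_at_topological by blast
    have "y \<notin> Z" if "y \<in> T" for y
    proof (cases "y = x")
      case False
      then have "F y \<noteq> 0" using T that by blast
      then show ?thesis unfolding Z_def eventually_nhds by blast
    qed (use x in simp)
    then show "\<exists>T. open T \<and> x \<in> T \<and> T \<subseteq> - Z" using T by blast
  qed
  moreover have "a \<in> Z" using zero by (simp add: Z_def)
  ultimately have "Z = UNIV" using connected_UNIV[where 'a=real] unfolding connected_clopen
    by (auto simp: open_closed)
  then have "x \<in> Z" by simp
  then show ?thesis unfolding Z_def using eventually_nhds_x_imp_x by blast
qed

lemma real_analytic_diff:
  assumes "real_analytic F" "real_analytic G"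
  shows "real_analytic (\<lambda>x. F x - G x)"
  using assms has_fps_expansion_diff unfolding real_analytic_def by blast

lemma real_analytic_sign_near_0:
  assumes an: "real_analytic D" and cont: "continuous_on UNIV D" and ne: "D x \<noteq> 0"
  obtains s0 where "s0 > 0" "(\<forall>s. 0 < s \<and> s < s0 \<longrightarrow> D s > 0) \<or> (\<forall>s. 0 < s \<and> s < s0 \<longrightarrow> D s < 0)"
proof -
  have "\<not> (\<forall>\<^sub>F y in nhds 0. D y = 0)" using real_analytic_identity[OF an] ne by blast
  then have "\<forall>\<^sub>F y in at 0. D y \<noteq> 0"
    using an real_fps_zero_or_isolated_zero unfolding real_analytic_def by blast
  then obtain s0 where s0: "s0 > 0" "\<And>s. s \<noteq> 0 \<Longrightarrow> \<bar>s\<bar> < s0 \<Longrightarrow> D s \<noteq> 0"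
    by (auto simp: eventually_at)
  have "\<not> (D s < 0 \<and> D t > 0)" if "0 < s" "s < s0" "0 < t" "t < s0" for s t
  proof
    assume st: "D s < 0 \<and> D t > 0"
    have "connected (D ` {0<..<s0})"
      by (rule connected_continuous_image[OF continuous_on_subset[OF cont]]) auto
    moreover have "D s \<in> D ` {0<..<s0}" "D t \<in> D ` {0<..<s0}" using that by auto
    ultimately have "0 \<in> D ` {0<..<s0}"
      using st connected_contains_Icc[of "D ` {0<..<s0}" "D s" "D t"] by auto
    then show False using s0(2) by force
  qed
  then have "(\<forall>s. 0 < s \<and> s < s0 \<longrightarrow> D s > 0) \<or> (\<forall>s. 0 < s \<and> s < s0 \<longrightarrow> D s < 0)"
    using s0(2) by (smt (verit))
  with s0(1) that show thesis by blast
qed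

lemma C2_real_DERIV: "C2_real F \<Longrightarrow> (F has_real_derivative deriv F x) (at x)"
  by (simp add: C2_real_def DERIV_deriv_iff_field_differentiable)

lemma C2_real_lipschitz:
  assumes "C2_real F" "0 \<le> R"
  obtains K where "K \<ge> 0" "\<And>s t. 0 \<le> s \<Longrightarrow> s \<le> t \<Longrightarrow> t \<le> R \<Longrightarrow> F s - F t \<le> K * (t - s)"
proof -
  have "continuous_on {0..R} (deriv F)"
    using assms(1) unfolding C2_real_def
    by (intro continuous_at_imp_continuous_on) (auto intro: field_differentiable_imp_continuous_at)
  then have "bounded (deriv F ` {0..R})" by (intro compact_imp_bounded compact_continuous_image) auto
  then obtain K where K: "K > 0" "\<And>x. x \<in> {0..R} \<Longrightarrow> \<bar>deriv F x\<bar> \<le> K"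
    unfolding bounded_pos by auto
  show thesis
  proof (rule that[of K])
    show "K \<ge> 0" using K by simp
    fix s t :: real assume st: "0 \<le> s" "s \<le> t" "t \<le> R"
    show "F s - F t \<le> K * (t - s)"
    proof (cases "s = t")
      case False
      then have "s < t" using st by simp
      from MVT2[OF this C2_real_DERIV[OF assms(1)]] obtain q where
        q: "s < q" "q < t" "F t - F s = (t - s) * deriv F q" by blast
      have "- deriv F q \<le> K" using K(2)[of q] q st by auto
      then have "(t - s) * - deriv F q \<le> (t - s) * K" using st by (intro mult_left_mono) auto
      then show ?thesis using q(3) by (simp add: algebra_simps)
    qed simp
  qed
qed

section \<open>Comparison of the boundary fluxes\<close>

text \<open>The solutions take values in \<open>[0, S]\<close>, so the gap between \<open>F1\<close> and \<open>F2\<close> acts as a source of constant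
  sign. The difference \<open>w\<close> of the solutions is positive inside and zero on the
  boundary, so by Hopf's lemma its derivative at \<open>x0\<close> along \<open>d = - a\<^sup>T \<nu>\<close>, which is minus the difference of the
  fluxes, is positive.\<close>

lemma conormal_derivatives_differ:
  fixes \<Omega> :: "(real^'n::finite) set"
  assumes domain: "open \<Omega>" "connected \<Omega>" "bounded \<Omega>"
    and boundary: "Ck_holder_boundary 2 \<alpha> \<Omega>"
    and a_C2: "\<forall>i j. Ck_closure 2 \<Omega> (\<lambda>x. a x $ i $ j)"
    and a_sym: "\<forall>x\<in>closure \<Omega>. \<forall>i j. a x $ i $ j = a x $ j $ i"
    and a_elliptic: "\<exists>c>0. \<forall>x\<in>closure \<Omega>. \<forall>\<xi>::real^'n.
           (\<Sum>i\<in>UNIV. \<Sum>j\<in>UNIV. a x $ i $ j * \<xi> $ i * \<xi> $ j) \<ge> c * (norm \<xi>)\<^sup>2"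
    and x0: "x0 \<in> frontier \<Omega>" and normal: "outward_unit_normal \<Omega> x0 (\<nu> x0)"
    and F1: "C2_real F1" "antimono F1" "F1 0 = 0"
    and F2: "antimono F2" "F2 0 = 0"
    and sol1: "is_solution \<alpha> \<Omega> a F1 h u1" and sol2: "is_solution \<alpha> \<Omega> a F2 h u2"
    and h: "\<And>x. x \<in> frontier \<Omega> \<Longrightarrow> 0 \<le> h x \<and> h x \<le> S" and h_ne: "\<exists>x\<in>frontier \<Omega>. h x \<noteq> 0"
    and gap: "\<And>s. 0 < s \<Longrightarrow> s \<le> S \<Longrightarrow> F2 s < F1 s"
  shows "conormal_deriv \<Omega> a \<nu> u1 x0 \<noteq> conormal_deriv \<Omega> a \<nu> u2 x0"
proof
  assume flux: "conormal_deriv \<Omega> a \<nu> u1 x0 = conormal_deriv \<Omega> a \<nu> u2 x0"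
  obtain c where c: "c > 0" and ell: "\<forall>x\<in>closure \<Omega>. \<forall>\<xi>::real^'n.
      (\<Sum>i\<in>UNIV. \<Sum>j\<in>UNIV. a x $ i $ j * \<xi> $ i * \<xi> $ j) \<ge> c * (norm \<xi>)\<^sup>2"
    using a_elliptic by blast
  obtain b T B where eo: "elliptic_operator \<Omega> a b c T B"
    and nondiv: "\<And>u x. Ck_closure 2 \<Omega> u \<Longrightarrow> x \<in> \<Omega> \<Longrightarrow> elliptic_op a u x = - nondiv_op a b (grad u) (hess u) x"
    using elliptic_op_nondivergence[OF domain(1,3) c a_C2 a_sym ell] by blast
  interpret elliptic_operator \<Omega> a b c T B by (rule eo)
  have sub: "\<Omega> \<subseteq> closure \<Omega>" by (rule closure_subset)
  have fr: "frontier \<Omega> \<subseteq> closure \<Omega>" by (simp add: frontier_def)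
  have S: "S \<ge> 0" using h[OF x0] by linarith
  have C: "Ck_closure 2 \<Omega> u1" "Ck_closure 2 \<Omega> u2"
    using sol1 sol2 by (auto simp: is_solution_def Ck_holder_closure_def)
  have bc: "u1 x = h x" "u2 x = h x" if "x \<in> frontier \<Omega>" for x
    using sol1 sol2 that by (auto simp: is_solution_def)
  have L1: "L (grad u1) (hess u1) x = - F1 (u1 x)" and L2: "L (grad u2) (hess u2) x = - F2 (u2 x)"
    if "x \<in> \<Omega>" for x
    using sol1 sol2 nondiv[OF C(1) that] nondiv[OF C(2) that] that by (auto simp: is_solution_def)
  note cont = Ck_closure_2D(1)[OF C(1)] Ck_closure_2D(1)[OF C(2)]
  note jet = Ck_closure_2_has_jet[OF domain(1) C(1)] Ck_closure_2_has_jet[OF domain(1) C(2)]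
  have range: "0 \<le> u x \<and> u x \<le> S"
    if u: "Ck_closure 2 \<Omega> u" "\<And>x. x \<in> frontier \<Omega> \<Longrightarrow> u x = h x"
      "\<And>x. x \<in> \<Omega> \<Longrightarrow> L (grad u) (hess u) x = - F (u x)" "antimono F" "F 0 = 0" and x: "x \<in> closure \<Omega>"
    for u F x
  proof
    note cont_u = Ck_closure_2D(1)[OF u(1)] and jet_u = Ck_closure_2_has_jet[OF domain(1) u(1)]
    show "0 \<le> u x"
    proof (rule comparison[OF cont_u jet_u _ _ x])
      show "0 \<le> u y" if "y \<in> frontier \<Omega>" for y using u(2) h that by simp
      show "L (grad u) (hess u) y \<le> 0" if "y \<in> \<Omega>" "u y < 0" for y
        using u(3)[OF that(1)] antimonoD[OF u(4), of "u y" 0] u(5) that(2) by simp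
    qed
    have "0 \<le> (-1) * u x + 0 * u x + S"
    proof (rule comparison[OF _ has_jet_lincomb[OF jet_u jet_u, of "-1" 0 S] _ _ x])
      show "continuous_on (closure \<Omega>) (\<lambda>x. (-1) * u x + 0 * u x + S)"
        by (intro continuous_intros cont_u)
      show "0 \<le> (-1) * u y + 0 * u y + S" if "y \<in> frontier \<Omega>" for y using u(2) h that by simp
      fix y assume y: "y \<in> \<Omega>" "(-1) * u y + 0 * u y + S < 0"
      then have "F (u y) \<le> 0" using antimonoD[OF u(4), of 0 "u y"] u(5) S by simp
      then show "L (\<lambda>x. (-1) *\<^sub>R grad u x + 0 *\<^sub>R grad u x) (\<lambda>x. (-1) *\<^sub>R hess u x + 0 *\<^sub>R hess u x) y \<le> 0"
        unfolding nondiv_op_lincomb using u(3)[OF y(1)] by simp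
    qed
    then show "u x \<le> S" by simp
  qed
  have range1: "0 \<le> u1 x \<and> u1 x \<le> S" if "x \<in> closure \<Omega>" for x
    using range[OF C(1) bc(1) L1 F1(2,3) that] by blast
  have range2: "0 \<le> u2 x \<and> u2 x \<le> S" if "x \<in> closure \<Omega>" for x
    using range[OF C(2) bc(2) L2 F2 that] by blast
  have gap': "F2 s \<le> F1 s" if "0 \<le> s" "s \<le> S" for s
    using gap[of s] that F1(3) F2(2) by (cases "s = 0") auto

  define w where "w x = 1 * u1 x + (-1) * u2 x + 0" for x
  define Gw where "Gw x = 1 *\<^sub>R grad u1 x + (-1) *\<^sub>R grad u2 x" for x
  define Hw where "Hw x = 1 *\<^sub>R hess u1 x + (-1) *\<^sub>R hess u2 x" for x
  have cont_w: "continuous_on (closure \<Omega>) w" unfolding w_def by (intro continuous_intros cont)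
  have jet_w: "has_jet \<Omega> w Gw Hw" unfolding w_def Gw_def Hw_def by (rule has_jet_lincomb[OF jet])
  have Lw: "L Gw Hw x = F2 (u2 x) - F1 (u1 x)" if "x \<in> \<Omega>" for x
    unfolding Gw_def Hw_def nondiv_op_lincomb using L1 L2 that by simp
  have w_fr: "w x = 0" if "x \<in> frontier \<Omega>" for x using bc that by (simp add: w_def)
  have w_nonneg: "w x \<ge> 0" if "x \<in> closure \<Omega>" for x
  proof (rule comparison[OF cont_w jet_w _ _ that])
    show "0 \<le> w y" if "y \<in> frontier \<Omega>" for y using w_fr that by simp
    fix y assume y: "y \<in> \<Omega>" "w y < 0"
    have "F1 (u1 y) \<ge> F1 (u2 y)" using y(2) by (intro antimonoD[OF F1(2)]) (simp add: w_def)
    moreover have "F1 (u2 y) \<ge> F2 (u2 y)" using range2 sub y(1) by (intro gap') auto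
    ultimately show "L Gw Hw y \<le> 0" using Lw[OF y(1)] by simp
  qed
  obtain K where K: "K \<ge> 0" "\<And>s t. 0 \<le> s \<Longrightarrow> s \<le> t \<Longrightarrow> t \<le> S \<Longrightarrow> F1 s - F1 t \<le> K * (t - s)"
    using C2_real_lipschitz[OF F1(1) S] by blast
  have super: "L Gw Hw x \<le> K * w x" if "x \<in> \<Omega>" for x
  proof -
    have x: "x \<in> closure \<Omega>" using that sub by blast
    have "F1 (u2 x) - F1 (u1 x) \<le> K * (u1 x - u2 x)"
      using range1[OF x] range2[OF x] w_nonneg[OF x] by (intro K(2)) (auto simp: w_def)
    moreover have "F2 (u2 x) \<le> F1 (u2 x)" using range2[OF x] by (intro gap') auto
    ultimately show ?thesis using Lw[OF that] by (simp add: w_def)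
  qed
  have w_pos: "w x > 0" if x: "x \<in> \<Omega>" for x
  proof (rule ccontr)
    assume "\<not> w x > 0"
    then have "w x = 0" using w_nonneg[of x] x sub by force
    then have w0: "w y = 0" if "y \<in> \<Omega>" for y
      using strong_minimum_principle[OF domain(2) cont_w w_nonneg jet_w K(1) super x] that by blast
    \<comment> \<open>At a zero of \<open>w\<close> the two solutions agree and \<open>L w \<ge> 0\<close>, which leaves no room for the gap.\<close>
    have "u2 y = 0" if y: "y \<in> \<Omega>" for y
    proof (rule ccontr)
      assume "u2 y \<noteq> 0"
      then have "F2 (u2 y) < F1 (u2 y)" using range2[of y] y sub by (intro gap) force+
      moreover have "u1 y = u2 y" using w0[OF y] by (simp add: w_def)
      moreover have "L Gw Hw y \<ge> 0"
        by (rule op_nonneg_at_interior_min[OF domain(1) order_refl y jet_w]) (use w0 y in auto)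
      ultimately show False using Lw[OF y] by simp
    qed
    then have "u2 y = 0" if "y \<in> closure \<Omega>" for y
      using continuous_constant_on_closure[OF cont(2) _ that] by blast
    then show False using h_ne bc(2) fr by fastforce
  qed

  obtain s where s: "s > 0" "ball (x0 - s *\<^sub>R \<nu> x0) s \<subseteq> \<Omega>"
    using boundary x0 interior_ball_of_chart[OF domain(1) _ x0 normal] unfolding Ck_holder_boundary_def
    by metis
  define z where "z = x0 - s *\<^sub>R \<nu> x0"
  define d where "d = - (\<chi> j. \<Sum>i\<in>UNIV. a x0 $ i $ j * \<nu> x0 $ i)"
  have norm_nu: "norm (\<nu> x0) = 1" using normal by (simp add: outward_unit_normal_def)
  have x0c: "x0 \<in> closure \<Omega>" using x0 fr by blast
  have nz: "norm (x0 - z) = s" using s(1) norm_nu by (simp add: z_def)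
  \<comment> \<open>\<open>z - x0 = - s *\<^sub>R \<nu> x0\<close>, so the inner product is \<open>s\<close> times the quadratic form of \<open>a x0\<close> at \<open>\<nu> x0\<close>.\<close>
  have dz: "d \<bullet> (z - x0) > 0"
  proof -
    have "d \<bullet> (z - x0) = s * (\<Sum>j\<in>UNIV. \<Sum>i\<in>UNIV. a x0 $ i $ j * \<nu> x0 $ i * \<nu> x0 $ j)"
      by (simp add: d_def z_def inner_vec_def sum_distrib_left sum_distrib_right sum_negf mult_ac)
    also have "\<dots> = s * (\<Sum>i\<in>UNIV. \<Sum>j\<in>UNIV. a x0 $ i $ j * \<nu> x0 $ i * \<nu> x0 $ j)"
      by (subst sum.swap) simp
    also have "\<dots> \<ge> s * c"
      using ell[rule_format, OF x0c, of "\<nu> x0"] norm_nu s(1) by (intro mult_left_mono) auto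
    finally show ?thesis using mult_pos_pos[OF s(1) c] by linarith
  qed
  have ball: "ball z s \<subseteq> \<Omega>" using s(2) by (simp add: z_def)
  have wpos_ball: "w x > 0" if "x \<in> ball z s" for x using w_pos ball that by blast
  obtain \<eta> where eta: "\<eta> > 0" "\<forall>\<^sub>F t in at_right 0. \<eta> * t \<le> w (x0 + t *\<^sub>R d)"
    by (rule hopf_oblique[OF cont_w w_nonneg jet_w K(1) super s(1) ball wpos_ball nz dz])
  have in_dom: "\<forall>\<^sub>F t in at_right 0. x0 + t *\<^sub>R d \<in> \<Omega>"
    using eventually_enters_ball[OF nz dz]
    by eventually_elim (use ball in \<open>auto simp: dist_norm norm_minus_commute\<close>)

  define E where "E = (\<chi> j. partial_cl \<Omega> j u1 x0 - partial_cl \<Omega> j u2 x0)"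
  have conormal: "conormal_deriv \<Omega> a \<nu> v x0 = - (d \<bullet> (\<chi> j. partial_cl \<Omega> j v x0))" for v
    unfolding conormal_deriv_def d_def
    by (subst sum.swap) (simp add: inner_vec_def sum_distrib_left sum_distrib_right mult_ac sum_negf)
  have "d \<bullet> E = d \<bullet> (\<chi> j. partial_cl \<Omega> j u1 x0) - d \<bullet> (\<chi> j. partial_cl \<Omega> j u2 x0)"
    by (simp add: E_def inner_diff_right[symmetric] vec_eq_iff inner_vec_def sum_subtractf[symmetric] algebra_simps)
  also have "\<dots> = 0" using flux by (simp add: conormal)
  finally have dE: "E \<bullet> d = 0" by (simp add: inner_commute)
  have to_x0: "((\<lambda>t. x0 + t *\<^sub>R d) \<longlongrightarrow> x0) (at_right 0)" by (auto intro!: tendsto_eq_intros)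
  have in_cl: "\<forall>\<^sub>F t in at_right 0. x0 + t *\<^sub>R d \<in> closure \<Omega>"
    using in_dom by eventually_elim (use sub in blast)
  \<comment> \<open>The gradient of \<open>w\<close> extends continuously to \<open>x0\<close>, so its component along \<open>d\<close> tends to minus the
     difference of the fluxes, which is zero.\<close>
  have lim: "((\<lambda>t. Gw (x0 + t *\<^sub>R d) \<bullet> d) \<longlongrightarrow> 0) (at_right 0)"
  proof -
    have pl: "((\<lambda>t. partial_cl \<Omega> j u (x0 + t *\<^sub>R d)) \<longlongrightarrow> partial_cl \<Omega> j u x0) (at_right 0)"
      if "Ck_closure 2 \<Omega> u" for u j
      by (rule continuous_on_tendsto_compose[OF Ck_closure_2D(2)[OF that] to_x0 x0c in_cl])
    have "((\<lambda>t. (\<chi> j. partial_cl \<Omega> j u1 (x0 + t *\<^sub>R d) - partial_cl \<Omega> j u2 (x0 + t *\<^sub>R d)) \<bullet> d) \<longlongrightarrow> E \<bullet> d) (at_right 0)"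
      unfolding E_def by (intro tendsto_intros pl C)
    moreover have "\<forall>\<^sub>F t in at_right 0.
        (\<chi> j. partial_cl \<Omega> j u1 (x0 + t *\<^sub>R d) - partial_cl \<Omega> j u2 (x0 + t *\<^sub>R d)) \<bullet> d = Gw (x0 + t *\<^sub>R d) \<bullet> d"
      using in_dom
    proof eventually_elim
      case (elim t)
      then have "(\<chi> j. partial_cl \<Omega> j u1 (x0 + t *\<^sub>R d) - partial_cl \<Omega> j u2 (x0 + t *\<^sub>R d)) = Gw (x0 + t *\<^sub>R d)"
        by (simp add: vec_eq_iff Gw_def grad_def partial_cl_def)
      then show ?case by simp
    qed
    ultimately show ?thesis unfolding dE by (rule Lim_transform_eventually)
  qed
  have "\<forall>\<^sub>F t in at_right 0. x0 + t *\<^sub>R d \<in> \<Omega> \<and> Gw (x0 + t *\<^sub>R d) \<bullet> d < \<eta> \<and> \<eta> * t \<le> w (x0 + t *\<^sub>R d)"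
    using in_dom order_tendstoD(2)[OF lim eta(1)] eta(2) by eventually_elim simp
  then obtain t1 where t1: "t1 > 0" "\<And>t. 0 < t \<Longrightarrow> t < t1 \<Longrightarrow>
      x0 + t *\<^sub>R d \<in> \<Omega> \<and> Gw (x0 + t *\<^sub>R d) \<bullet> d < \<eta> \<and> \<eta> * t \<le> w (x0 + t *\<^sub>R d)"
    unfolding eventually_at_right_field by auto
  define t where "t = t1 / 2"
  have t: "0 < t" "t < t1" using t1(1) by (simp_all add: t_def)
  \<comment> \<open>The mean value theorem now bounds \<open>w (x0 + t *\<^sub>R d)\<close> strictly below \<open>\<eta> * t\<close>.\<close>
  have der: "((\<lambda>t. w (x0 + t *\<^sub>R d)) has_real_derivative Gw (x0 + q *\<^sub>R d) \<bullet> d) (at q)" if "0 < q" "q < t" for q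
    using has_jet_line(1)[OF jet_w] t1(2)[of q] that t by simp
  have "continuous_on {0..t} (\<lambda>t. w (x0 + t *\<^sub>R d))"
  proof (rule continuous_on_compose2[OF cont_w])
    show "continuous_on {0..t} (\<lambda>t. x0 + t *\<^sub>R d)" by (intro continuous_intros)
    show "(\<lambda>t. x0 + t *\<^sub>R d) ` {0..t} \<subseteq> closure \<Omega>"
    proof clarify
      fix q assume "q \<in> {0..t}"
      then show "x0 + q *\<^sub>R d \<in> closure \<Omega>" using x0c t1(2)[of q] t sub by (cases "q = 0") auto
    qed
  qed
  then obtain l q where q: "0 < q" "q < t" "((\<lambda>t. w (x0 + t *\<^sub>R d)) has_real_derivative l) (at q)"
    "w (x0 + t *\<^sub>R d) - w (x0 + 0 *\<^sub>R d) = (t - 0) * l"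
    using MVT[OF t(1), of "\<lambda>t. w (x0 + t *\<^sub>R d)"] der unfolding real_differentiable_def by blast
  have "l = Gw (x0 + q *\<^sub>R d) \<bullet> d" using DERIV_unique[OF q(3) der] q by simp
  then have "l < \<eta>" using t1(2)[of q] q t by simp
  then have "t * l < t * \<eta>" using t(1) by simp
  then show False using q(4) w_fr[OF x0] t1(2)[OF t] by (simp add: mult.commute)
qed

theorem corollary2p2:
  fixes \<Omega> :: "(real^'n::finite) set"
    and \<alpha> R :: real
    and a :: "real^'n \<Rightarrow> real^'n^'n"
    and g :: "real^'n \<Rightarrow> real"
    and \<nu> :: "real^'n \<Rightarrow> real^'n"
    and F1 F2 :: "real \<Rightarrow> real"
    and u1 u2 :: "real \<Rightarrow> real^'n \<Rightarrow> real"
    and x0 :: "real^'n"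
    and \<delta> :: "nat \<Rightarrow> real"
  assumes dim: "CARD('n) \<ge> 2"
    and alpha: "0 < \<alpha>" "\<alpha> < 1"
    and domain: "open \<Omega>" "connected \<Omega>" "bounded \<Omega>"
    and boundary: "Ck_holder_boundary 2 \<alpha> \<Omega>"
    and a_C2: "\<forall>i j. Ck_closure 2 \<Omega> (\<lambda>x. a x $ i $ j)"
    and a_sym: "\<forall>x\<in>closure \<Omega>. \<forall>i j. a x $ i $ j = a x $ j $ i"
    and a_elliptic: "\<exists>c>0. \<forall>x\<in>closure \<Omega>. \<forall>\<xi>::real^'n.
           (\<Sum>i\<in>UNIV. \<Sum>j\<in>UNIV. a x $ i $ j * \<xi> $ i * \<xi> $ j) \<ge> c * (norm \<xi>)\<^sup>2"
    and g_reg: "Ck_holder_on_boundary 2 \<alpha> \<Omega> g"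
    and g_range: "R > 0" "g ` frontier \<Omega> = {0..R}"
    and normal: "\<forall>x\<in>frontier \<Omega>. outward_unit_normal \<Omega> x (\<nu> x)"
    and F1: "C2_real F1" "antimono F1" "F1 0 = 0" "real_analytic F1"
    and F2: "C2_real F2" "antimono F2" "F2 0 = 0" "real_analytic F2"
    and u1: "\<forall>d\<in>{0..1}. is_solution \<alpha> \<Omega> a F1 (\<lambda>x. d * g x) (u1 d)"
    and u2: "\<forall>d\<in>{0..1}. is_solution \<alpha> \<Omega> a F2 (\<lambda>x. d * g x) (u2 d)"
    and x0: "x0 \<in> frontier \<Omega>"
    and delta: "\<forall>k. \<delta> k \<in> {0<..1}" "decseq \<delta>" "\<delta> \<longlonglongrightarrow> 0"
    and flux: "\<forall>k. conormal_deriv \<Omega> a \<nu> (u1 (\<delta> k)) x0 = conormal_deriv \<Omega> a \<nu> (u2 (\<delta> k)) x0"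
  shows "F1 = F2"
proof (rule ccontr)
  assume "F1 \<noteq> F2"
  then obtain x where x: "F1 x - F2 x \<noteq> 0" by (auto simp: fun_eq_iff)
  have "continuous_on UNIV F" if "C2_real F" for F
    using that unfolding C2_real_def
    by (intro continuous_at_imp_continuous_on) (auto intro: field_differentiable_imp_continuous_at)
  then have "continuous_on UNIV (\<lambda>x. F1 x - F2 x)" using F1 F2 by (intro continuous_on_diff) auto
  from real_analytic_sign_near_0[OF real_analytic_diff[OF F1(4) F2(4)] this x]
  obtain s0 where s0: "s0 > 0" "(\<forall>s. 0 < s \<and> s < s0 \<longrightarrow> F1 s - F2 s > 0) \<or> (\<forall>s. 0 < s \<and> s < s0 \<longrightarrow> F1 s - F2 s < 0)"
    by blast
  have "\<forall>\<^sub>F k in sequentially. \<delta> k < s0 / R"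
    using order_tendstoD(2)[OF delta(3)] s0(1) g_range(1) by simp
  then obtain k where "\<delta> k < s0 / R" by (auto simp: eventually_sequentially)
  then have k: "\<delta> k * R < s0" using g_range(1) by (simp add: pos_less_divide_eq)
  have dk: "0 < \<delta> k" "\<delta> k \<in> {0..1}" using delta(1) by (auto simp: less_imp_le)
  have sol: "is_solution \<alpha> \<Omega> a F1 (\<lambda>x. \<delta> k * g x) (u1 (\<delta> k))" "is_solution \<alpha> \<Omega> a F2 (\<lambda>x. \<delta> k * g x) (u2 (\<delta> k))"
    using u1 u2 dk by auto
  have range: "0 \<le> \<delta> k * g y \<and> \<delta> k * g y \<le> \<delta> k * R" if "y \<in> frontier \<Omega>" for y
  proof -
    have "g y \<in> {0..R}" using g_range(2) that by blast
    then show ?thesis using dk(1) by simp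
  qed
  have "R \<in> g ` frontier \<Omega>" using g_range by simp
  then have ne: "\<exists>y\<in>frontier \<Omega>. \<delta> k * g y \<noteq> 0" using dk(1) g_range(1) by force
  have nu: "outward_unit_normal \<Omega> x0 (\<nu> x0)" using normal x0 by blast
  note differ = conormal_derivatives_differ[where a = a and \<nu> = \<nu> and h = "\<lambda>x. \<delta> k * g x" and S = "\<delta> k * R",
      OF domain boundary a_C2 a_sym a_elliptic x0 nu]
  from s0(2) show False
  proof
    assume "\<forall>s. 0 < s \<and> s < s0 \<longrightarrow> F1 s - F2 s > 0"
    then have "F2 s < F1 s" if "0 < s" "s \<le> \<delta> k * R" for s using that k by simp
    from differ[OF F1(1-3) F2(2,3) sol range ne this] flux show False by blast
  next
    assume "\<forall>s. 0 < s \<and> s < s0 \<longrightarrow> F1 s - F2 s < 0"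
    then have "F1 s < F2 s" if "0 < s" "s \<le> \<delta> k * R" for s using that k by simp
    from differ[OF F2(1-3) F1(2,3) sol(2,1) range ne this] flux show False by metis
  qed
qed

end
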